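(* Up to isomorphism, there are exactly two $3$-non-compliant graphs on $14$ vertices: the graph obtained from $QR_{13}$ by adding a new vertex adjacent exactly to the vertices of the open neighborhood $N(w)$ of some existing vertex $w$, and the graph obtained from $QR_{13}$ by adding a new vertex adjacent exactly to the vertices of the closed neighborhood $N(w)\cup\{w\}$ of some existing vertex $w$.
   Context: All graphs are finite, simple and undirected; $\overline{G}$ denotes the complement of $G$. A minor of $G$ is a graph obtained from $G$ by a sequence of vertex deletions, edge deletions and edge contractions (contraction identifies the endpoints of an edge and removes loops and multiple edges). $\Delta(H)$ is the maximum degree of $H$. For an integer $k\ge 1$, a graph $G$ on $n$ vertices is $k$-compliant if $G$ or $\overline{G}$ has a minor $H$ with $\Delta(H)\ge n-k$; otherwise $G$ is $k$-non-compliant. The Paley graph $QR_{13}$ has vertex set $\mathbb{Z}/13\mathbb{Z}$, with $x\ne y$ adjacent iff $x-y$ is a nonzero quadratic residue modulo $13$. $QR_{13}$ is vertex-transitive, so the choice of $w$ does not matter up to isomorphism. *)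

theory Defs
  imports
    "Graph_Theory.Pair_Digraph"
    "Graph_Theory.Digraph_Isomorphism"
    "HOL-Number_Theory.Residues"
begin

text \<open>
  A finite simple undirected graph is a \<^locale>\<open>pair_graph\<close>: a finite loop-free digraph
  with a symmetric arc set, an edge between u and v being the two arcs (u,v) and (v,u).
  In such a graph the degree of a vertex is its \<^const>\<open>out_degree\<close>.
\<close>

definition max_degree :: "'a pair_pre_digraph \<Rightarrow> nat" where
  \<comment> \<open>The inserted 0 only matters for the graph without vertices.\<close>
  "max_degree G = Max (insert 0 (out_degree (with_proj G) ` pverts G))"

definition complement :: "'a pair_pre_digraph \<Rightarrow> 'a pair_pre_digraph" where
  "complement G =
     \<lparr>pverts = pverts G,
      parcs = {(x, y) \<in> pverts G \<times> pverts G. x \<noteq> y \<and> (x, y) \<notin> parcs G}\<rparr>"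

definition delete_vertex :: "'a pair_pre_digraph \<Rightarrow> 'a \<Rightarrow> 'a pair_pre_digraph" where
  "delete_vertex G v =
     \<lparr>pverts = pverts G - {v}, parcs = {(x, y) \<in> parcs G. x \<noteq> v \<and> y \<noteq> v}\<rparr>"

definition delete_edge :: "'a pair_pre_digraph \<Rightarrow> 'a \<Rightarrow> 'a \<Rightarrow> 'a pair_pre_digraph" where
  "delete_edge G u v = \<lparr>pverts = pverts G, parcs = parcs G - {(u, v), (v, u)}\<rparr>"

text \<open>
  The vertex obtained by identifying u and v is again called u. Removing \<^const>\<open>Id\<close> removes
  the loop; multiple edges cannot arise because \<^const>\<open>parcs\<close> is a set of pairs.
\<close>

definition contract_edge :: "'a pair_pre_digraph \<Rightarrow> 'a \<Rightarrow> 'a \<Rightarrow> 'a pair_pre_digraph" where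
  "contract_edge G u v =
     \<lparr>pverts = pverts G - {v}, parcs = map_prod (id(v := u)) (id(v := u)) ` parcs G - Id\<rparr>"

inductive minor_step :: "'a pair_pre_digraph \<Rightarrow> 'a pair_pre_digraph \<Rightarrow> bool" where
  "v \<in> pverts G \<Longrightarrow> minor_step G (delete_vertex G v)"
| "(u, v) \<in> parcs G \<Longrightarrow> minor_step G (delete_edge G u v)"
| "(u, v) \<in> parcs G \<Longrightarrow> minor_step G (contract_edge G u v)"

definition is_minor :: "'a pair_pre_digraph \<Rightarrow> 'a pair_pre_digraph \<Rightarrow> bool" where
  "is_minor H G \<longleftrightarrow> minor_step\<^sup>*\<^sup>* G H"

definition compliant :: "nat \<Rightarrow> 'a pair_pre_digraph \<Rightarrow> bool" where
  "compliant k G \<longleftrightarrow>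
     (\<exists>H. (is_minor H G \<or> is_minor H (complement G)) \<and>
          int (max_degree H) \<ge> int (card (pverts G)) - int k)"

text \<open>The residue classes modulo 13 are represented by 0, ..., 12.\<close>

definition QR13 :: "int pair_pre_digraph" where
  "QR13 =
     \<lparr>pverts = {0..<13},
      parcs = {(x, y) \<in> {0..<13} \<times> {0..<13}. x \<noteq> y \<and> QuadRes 13 (x - y)}\<rparr>"

definition open_nbh :: "'a pair_pre_digraph \<Rightarrow> 'a \<Rightarrow> 'a set" where
  "open_nbh G w = {v. (w, v) \<in> parcs G}"

definition closed_nbh :: "'a pair_pre_digraph \<Rightarrow> 'a \<Rightarrow> 'a set" where
  "closed_nbh G w = insert w (open_nbh G w)"

text \<open>
  The new vertex, adjacent exactly to the vertices in S, is \<^const>\<open>None\<close>; an old vertex v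
  becomes \<^term>\<open>Some v\<close>.
\<close>

definition add_vertex :: "'a pair_pre_digraph \<Rightarrow> 'a set \<Rightarrow> 'a option pair_pre_digraph" where
  "add_vertex G S =
     \<lparr>pverts = insert None (Some ` pverts G),
      parcs = map_prod Some Some ` parcs G \<union> {None} \<times> Some ` S \<union> Some ` S \<times> {None}\<rparr>"

definition QR13_open_twin :: "int \<Rightarrow> int option pair_pre_digraph" where
  "QR13_open_twin w = add_vertex QR13 (open_nbh QR13 w)"

definition QR13_closed_twin :: "int \<Rightarrow> int option pair_pre_digraph" where
  "QR13_closed_twin w = add_vertex QR13 (closed_nbh QR13 w)"

lemma pair_graph_iff:
  "pair_graph G \<longleftrightarrow>
     finite (pverts G) \<and> parcs G \<subseteq> pverts G \<times> pverts G \<and> sym (parcs G) \<and> irrefl (parcs G)"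
proof
  assume "pair_graph G"
  then interpret pair_graph G .
  show "finite (pverts G) \<and> parcs G \<subseteq> pverts G \<times> pverts G \<and> sym (parcs G) \<and> irrefl (parcs G)"
    using pair_finite_verts pair_sym_arcs in_arcsD1 in_arcsD2
    by (auto simp: symmetric_def irrefl_def dest: pair_no_loops)
next
  assume *: "finite (pverts G) \<and> parcs G \<subseteq> pverts G \<times> pverts G \<and> sym (parcs G) \<and> irrefl (parcs G)"
  then have "finite (parcs G)"
    using finite_subset by blast
  with * show "pair_graph G"
    by unfold_locales (auto simp: symmetric_def irrefl_def)
qed

lemma pair_graph_complement: "pair_graph G \<Longrightarrow> pair_graph (complement G)"
  by (auto simp: pair_graph_iff complement_def sym_def irrefl_def)

lemma minor_step_pair_graph:
  assumes "minor_step G H" "pair_graph G"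
  shows "pair_graph H"
  using assms(1)
proof cases
  case (1 v)
  with assms(2) show ?thesis
    by (auto simp: pair_graph_iff delete_vertex_def sym_def irrefl_def)
next
  case (2 u v)
  with assms(2) show ?thesis
    by (auto simp: pair_graph_iff delete_edge_def sym_def irrefl_def)
next
  case (3 u v)
  have f: "(id(v := u)) x \<in> pverts G - {v}" if "x \<in> pverts G" for x
    using that 3(2) assms(2) by (auto simp: pair_graph_iff irrefl_def)
  have "sym (map_prod (id(v := u)) (id(v := u)) ` parcs G)"
    using assms(2) by (force simp: pair_graph_iff sym_def)
  then have "sym (parcs H)"
    unfolding 3(1) contract_edge_def by (auto simp: sym_def)
  moreover have "parcs H \<subseteq> pverts H \<times> pverts H"
    using assms(2) f unfolding 3(1) contract_edge_def pair_graph_iff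
    by (auto simp del: fun_upd_apply)
  ultimately show ?thesis
    using assms(2) by (auto simp: pair_graph_iff 3(1) contract_edge_def irrefl_def)
qed

lemma is_minor_pair_graph:
  assumes "is_minor H G" "pair_graph G"
  shows "pair_graph H"
  using assms(1)[unfolded is_minor_def] assms(2)
  by (induction rule: rtranclp_induct) (auto intro: minor_step_pair_graph)

lemma QuadRes_13_uminus:
  assumes "QuadRes 13 a"
  shows "QuadRes 13 (- a)"
proof -
  obtain y where "[y\<^sup>2 = a] (mod 13)"
    using assms by (auto simp: QuadRes_def)
  then have "[25 * y\<^sup>2 = 25 * a] (mod 13)"
    by (rule cong_scalar_left)
  moreover have "[25 * a = - a] (mod 13)"
    by (simp add: cong_iff_dvd_diff)
  ultimately have "[(5 * y)\<^sup>2 = - a] (mod 13)"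
    using cong_trans by (simp add: power_mult_distrib) blast
  then show ?thesis
    unfolding QuadRes_def by blast
qed

lemma pair_graph_QR13: "pair_graph QR13"
  using QuadRes_13_uminus[of "x - y" for x y]
  by (auto simp: pair_graph_iff QR13_def sym_def irrefl_def)

lemma pair_graph_add_vertex:
  "pair_graph G \<Longrightarrow> S \<subseteq> pverts G \<Longrightarrow> pair_graph (add_vertex G S)"
  by (auto simp: pair_graph_iff add_vertex_def sym_def irrefl_def)

end

theory Submission
  imports Defs
begin

text \<open>
  Contracting two edges xy and xz produces a vertex of degree n - 3 as soon as x, y, z dominate
  the graph. Hence a graph on 14 vertices is 3-non-compliant iff in the graph and in its complement
  any three vertices that span at least two edges have a common non-neighbour.

  For a vertex v with set A of neighbours and set B of non-neighbours, this condition says that the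
  traces on A of the neighbourhoods of the vertices in B pairwise intersect, and that every pair in
  A is missed by one of these traces. It follows that all degrees are 6 or 7, so that v can be
  chosen of degree 6 after passing to the complement. Then at least three vertices of A have exactly
  four neighbours in B, which leaves 20 possibilities for the edges between them and B, up to the
  order of B. In each of them propositional reasoning shows that the graph has two twins, that is,
  vertices with the same neighbours among the remaining vertices.

  Deleting one of two twins preserves the condition, and propositional reasoning identifies the
  remaining graph on 13 vertices with the Paley graph.
\<close>

section \<open>Undominated paths of length two\<close>

text \<open>A minor of large maximum degree yields a dominating star only indirectly: a branch set
  that meets at least n - 3 other branch sets may have just one or two vertices. Degree bounds
  exclude the first case and, in the second, enlarge the set to three vertices that dominate the
  graph. The degrees are therefore bounded from the condition on triples alone, before its
  equivalence with non-compliance is available. The obstacle to purely propositional reasoning is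
  relabelling, since each graph occurs under many vertex orders. The orders are normalised by
  sorting vertices according to their adjacency to a few chosen ones. On 14 vertices the solver is
  asked only for a contradiction with the absence of twins, so that the two solutions need no normal
  form there. On 13 vertices all degrees are 6 in the graph and in the complement, and the vertex
  order can be normalised so far that only two matrices remain.\<close>

definition co :: "('a \<Rightarrow> 'a \<Rightarrow> bool) \<Rightarrow> 'a \<Rightarrow> 'a \<Rightarrow> bool" where
  "co e x y \<longleftrightarrow> x \<noteq> y \<and> \<not> e x y"

definition undominated :: "'a set \<Rightarrow> ('a \<Rightarrow> 'a \<Rightarrow> bool) \<Rightarrow> bool" where
  "undominated V e \<longleftrightarrow>
     (\<forall>x\<in>V. \<forall>y\<in>V. \<forall>z\<in>V. y \<noteq> z \<and> e x y \<and> e x z \<longrightarrow> (\<exists>u\<in>V. co e x u \<and> co e y u \<and> co e z u))"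

lemma undominated_cong:
  assumes "\<And>x y. x \<in> V \<Longrightarrow> y \<in> V \<Longrightarrow> e x y = f x y"
  shows "undominated V e = undominated V f"
  using assms unfolding undominated_def co_def by (intro ball_cong) (auto intro!: ball_cong)

definition adj :: "'a pair_pre_digraph \<Rightarrow> 'a \<Rightarrow> 'a \<Rightarrow> bool" where
  "adj G x y \<longleftrightarrow> (x, y) \<in> parcs G"

locale sgraph =
  fixes V :: "'a set" and e :: "'a \<Rightarrow> 'a \<Rightarrow> bool"
  assumes finite_V: "finite V"
    and sym: "e x y \<Longrightarrow> e y x"
    and irrefl: "\<not> e x x"
begin

lemma co_co: "co (co e) = e"
  using irrefl by (auto simp: co_def fun_eq_iff)

lemma sgraph_co: "sgraph V (co e)"
  using finite_V sym by unfold_locales (auto simp: co_def)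

end

lemma sgraph_adj: "pair_graph G \<Longrightarrow> sgraph (pverts G) (adj G)"
  by unfold_locales (auto simp: pair_graph_iff adj_def sym_def irrefl_def)

lemma adj_complement:
  "x \<in> pverts G \<Longrightarrow> y \<in> pverts G \<Longrightarrow> adj (complement G) x y = co (adj G) x y"
  by (auto simp: adj_def complement_def co_def)

lemma pverts_complement [simp]: "pverts (complement G) = pverts G"
  by (simp add: complement_def)

section \<open>Minors of large maximum degree\<close>

lemma out_degree_pair: "out_degree (with_proj H) x = card {y. adj H x y}"
proof -
  have "out_arcs (with_proj H) x = Pair x ` {y. adj H x y}"
    by (auto simp: out_arcs_def adj_def)
  then show ?thesis
    by (simp add: out_degree_def card_image inj_on_def)
qed

lemma out_degree_le_max_degree:
  assumes "pair_graph H" "x \<in> pverts H"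
  shows "out_degree (with_proj H) x \<le> max_degree H"
  using assms by (auto simp: max_degree_def pair_graph_iff)

lemma dominating_star_minor:
  assumes G: "pair_graph G" and xyz: "adj G x y" "adj G x z" "y \<noteq> z"
    and dom: "\<And>u. u \<in> pverts G - {x, y, z} \<Longrightarrow> adj G x u \<or> adj G y u \<or> adj G z u"
  shows "\<exists>H. is_minor H G \<and> card (pverts G) \<le> max_degree H + 3"
proof -
  interpret sgraph "pverts G" "adj G"
    using G by (rule sgraph_adj)
  have V: "x \<in> pverts G" "y \<in> pverts G" "z \<in> pverts G"
    using xyz G by (auto simp: adj_def pair_graph_iff)
  have ne: "x \<noteq> y" "x \<noteq> z"
    using xyz irrefl by auto
  define F where "F = contract_edge G x y"
  define H where "H = contract_edge F x z"
  \<comment> \<open>The merged vertex keeps the name \<open>x\<close>. The second premise excludes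
    the arcs that become loops, which \<open>contract_edge\<close> removes.\<close>
  have F_arc: "((id(y := x)) p, (id(y := x)) q) \<in> parcs F"
    if "(p, q) \<in> parcs G" "(id(y := x)) p \<noteq> (id(y := x)) q" for p q
    using that unfolding F_def contract_edge_def
    by (auto simp del: fun_upd_apply simp: image_iff intro!: bexI[of _ "(p, q)"])
  have H_arc: "((id(z := x)) p, (id(z := x)) q) \<in> parcs H"
    if "(p, q) \<in> parcs F" "(id(z := x)) p \<noteq> (id(z := x)) q" for p q
    using that unfolding H_def contract_edge_def
    by (auto simp del: fun_upd_apply simp: image_iff intro!: bexI[of _ "(p, q)"])
  have "(x, z) \<in> parcs F"
    using F_arc[of x z] xyz ne by (simp add: adj_def)
  then have "minor_step G F" "minor_step F H"
    using xyz minor_step.intros(3) by (auto simp: F_def H_def adj_def)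
  then have minor: "is_minor H G"
    by (simp add: is_minor_def)
  have pH: "pair_graph H"
    using is_minor_pair_graph[OF minor G] .
  have vH: "pverts H = pverts G - {y, z}"
    by (auto simp: H_def F_def contract_edge_def)
  have "pverts G - {x, y, z} \<subseteq> {u. adj H x u}"
  proof
    fix u assume u: "u \<in> pverts G - {x, y, z}"
    then obtain w where w: "w \<in> {x, y, z}" "(w, u) \<in> parcs G"
      using dom by (auto simp: adj_def)
    have "((id(y := x)) w, u) \<in> parcs F"
      using F_arc[OF w(2)] u w(1) by auto
    then have "((id(z := x)) ((id(y := x)) w), u) \<in> parcs H"
      using H_arc[of "(id(y := x)) w" u] u w(1) by auto
    then show "u \<in> {u. adj H x u}"
      using w(1) by (auto simp: adj_def split: if_splits)
  qed
  moreover have "finite {u. adj H x u}"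
    using pH by (auto simp: pair_graph_iff adj_def intro: finite_subset[of _ "pverts H"])
  ultimately have "card (pverts G - {x, y, z}) \<le> out_degree (with_proj H) x"
    unfolding out_degree_pair by (rule card_mono[rotated])
  also have "\<dots> \<le> max_degree H"
    using pH V ne vH by (intro out_degree_le_max_degree) auto
  finally have "card (pverts G) - card {x, y, z} \<le> max_degree H"
    using V by (simp add: card_Diff_subset)
  then show ?thesis
    using minor ne xyz(3) by (intro exI[of _ H]) auto
qed

lemma undominated_if_no_minor:
  assumes G: "pair_graph G"
    and "\<And>H. is_minor H G \<Longrightarrow> max_degree H + 3 < card (pverts G)"
  shows "undominated (pverts G) (adj G)"
proof (unfold undominated_def, intro ballI impI, rule ccontr)
  fix x y z
  assume xyz: "y \<noteq> z \<and> adj G x y \<and> adj G x z"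
    and no: "\<not> (\<exists>u\<in>pverts G. co (adj G) x u \<and> co (adj G) y u \<and> co (adj G) z u)"
  have "adj G x u \<or> adj G y u \<or> adj G z u" if "u \<in> pverts G - {x, y, z}" for u
    using no that by (auto simp: co_def)
  from dominating_star_minor[OF G _ _ _ this] xyz show False
    using assms(2) by (meson not_le)
qed

text \<open>Connectedness is expressed by edges across cuts instead of paths: this form is easy to
  preserve under unions, and for sets of two or three vertices it directly yields the edges.\<close>

definition cut_connected :: "('a \<Rightarrow> 'a \<Rightarrow> bool) \<Rightarrow> 'a set \<Rightarrow> bool" where
  "cut_connected e S \<longleftrightarrow>
     (\<forall>P Q. P \<union> Q = S \<and> P \<inter> Q = {} \<and> P \<noteq> {} \<and> Q \<noteq> {} \<longrightarrow> (\<exists>p\<in>P. \<exists>q\<in>Q. e p q))"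

text \<open>A cut of the union either separates \<open>s\<close> from \<open>t\<close>, and then the
  given edge crosses it in one of its two directions, or it splits \<open>S\<close> or
  \<open>T\<close>.\<close>

lemma cut_connected_Un:
  assumes "cut_connected e S" "cut_connected e T" and st: "s \<in> S" "t \<in> T" "e s t" "e t s"
  shows "cut_connected e (S \<union> T)"
  unfolding cut_connected_def
proof (intro allI impI)
  fix P Q assume PQ: "P \<union> Q = S \<union> T \<and> P \<inter> Q = {} \<and> P \<noteq> {} \<and> Q \<noteq> {}"
  have *: "\<exists>p\<in>P. \<exists>q\<in>Q. e p q"
    if "cut_connected e U" "U \<subseteq> P \<union> Q" "U \<inter> P \<noteq> {}" "U \<inter> Q \<noteq> {}" for U
  proof -
    have "(U \<inter> P) \<union> (U \<inter> Q) = U" "(U \<inter> P) \<inter> (U \<inter> Q) = {}"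
      using that(2) PQ by auto
    then show ?thesis
      using that(1,3,4) unfolding cut_connected_def by (metis IntD2)
  qed
  show "\<exists>p\<in>P. \<exists>q\<in>Q. e p q"
  proof (cases "s \<in> P \<longleftrightarrow> t \<in> P")
    case True
    show ?thesis
    proof (rule ccontr)
      assume no: "\<not> ?thesis"
      have "S \<inter> P = {} \<or> S \<inter> Q = {}" "T \<inter> P = {} \<or> T \<inter> Q = {}"
        using *[OF assms(1)] *[OF assms(2)] PQ no by auto
      then show False
        using True PQ st by blast
    qed
  next
    case False
    then show ?thesis
      using PQ st by blast
  qed
qed

lemma cut_connected_singleton: "cut_connected e {x}"
  by (auto simp: cut_connected_def Un_singleton_iff)

text \<open>A minor model of \<open>H\<close> in \<open>G\<close>. Adjacency is asked for in one
  direction only, so that deletions merely weaken the conditions, while a contraction unites two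
  branch sets.\<close>

definition branch_sets :: "'a pair_pre_digraph \<Rightarrow> 'a pair_pre_digraph \<Rightarrow> ('a \<Rightarrow> 'a set) \<Rightarrow> bool" where
  "branch_sets G H B \<longleftrightarrow>
     (\<forall>h\<in>pverts H. B h \<noteq> {} \<and> B h \<subseteq> pverts G \<and> cut_connected (adj G) (B h)) \<and>
     (\<forall>h\<in>pverts H. \<forall>k\<in>pverts H. h \<noteq> k \<longrightarrow> B h \<inter> B k = {}) \<and>
     (\<forall>h k. adj H h k \<longrightarrow> (\<exists>x\<in>B h. \<exists>y\<in>B k. adj G x y))"

lemma branch_setsD:
  assumes "branch_sets G H B"
  shows "h \<in> pverts H \<Longrightarrow> B h \<noteq> {}" "h \<in> pverts H \<Longrightarrow> B h \<subseteq> pverts G"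
    "h \<in> pverts H \<Longrightarrow> cut_connected (adj G) (B h)"
    "h \<in> pverts H \<Longrightarrow> k \<in> pverts H \<Longrightarrow> h \<noteq> k \<Longrightarrow> B h \<inter> B k = {}"
    "adj H h k \<Longrightarrow> \<exists>x\<in>B h. \<exists>y\<in>B k. adj G x y"
  using assms unfolding branch_sets_def by auto

lemma minor_branch_sets:
  assumes "is_minor H G" and G: "pair_graph G"
  shows "\<exists>B. branch_sets G H B"
  using assms(1)[unfolded is_minor_def]
proof (induction rule: rtranclp_induct)
  case base
  show ?case
    by (intro exI[of _ "\<lambda>h. {h}"]) (auto simp: branch_sets_def cut_connected_singleton)
next
  case (step H K)
  interpret sgraph "pverts G" "adj G"
    using G by (rule sgraph_adj)
  have H: "pair_graph H"
    using is_minor_pair_graph[OF _ G] step.hyps(1) by (simp add: is_minor_def)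
  obtain B where "branch_sets G H B"
    using step.IH by blast
  note B = branch_setsD[OF this]
  from step.hyps(2) show ?case
  proof cases
    case (1 v)
    then show ?thesis
      using B by (intro exI[of _ B]) (auto simp: branch_sets_def delete_vertex_def adj_def)
  next
    case (2 u v)
    then show ?thesis
      using B by (intro exI[of _ B]) (auto simp: branch_sets_def delete_edge_def adj_def)
  next
    case (3 u v)
    have uv: "u \<in> pverts H" "v \<in> pverts H" "u \<noteq> v" "adj H u v"
      using 3(2) H by (auto simp: pair_graph_iff irrefl_def adj_def)
    define C where "C = B(u := B u \<union> B v)"
    have vK: "pverts K = pverts H - {v}"
      using 3(1) by (simp add: contract_edge_def)
    have "cut_connected (adj G) (B u \<union> B v)"
      using B(3)[OF uv(1)] B(3)[OF uv(2)] B(5)[OF uv(4)] sym cut_connected_Un by metis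
    then have "\<forall>h\<in>pverts K. C h \<noteq> {} \<and> C h \<subseteq> pverts G \<and> cut_connected (adj G) (C h)"
      using B(1-3) uv by (auto simp: C_def vK)
    moreover have "\<forall>h\<in>pverts K. \<forall>k\<in>pverts K. h \<noteq> k \<longrightarrow> C h \<inter> C k = {}"
    proof (intro ballI impI)
      fix h k assume hk: "h \<in> pverts K" "k \<in> pverts K" "h \<noteq> k"
      then have "h \<in> pverts H" "k \<in> pverts H" "h \<noteq> v" "k \<noteq> v"
        by (auto simp: vK)
      then show "C h \<inter> C k = {}"
        using B(4)[of h k] B(4)[of h v] B(4)[of v k] hk(3) uv(2) by (auto simp: C_def)
    qed
    moreover have "\<exists>x\<in>C h. \<exists>y\<in>C k. adj G x y" if "adj K h k" for h k
    proof -
      have "(h, k) \<in> map_prod (id(v := u)) (id(v := u)) ` parcs H"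
        using that unfolding adj_def 3(1) contract_edge_def by simp
      then obtain p q where pq: "(p, q) \<in> parcs H" "h = (id(v := u)) p" "k = (id(v := u)) q"
        unfolding image_iff by (metis map_prod_simp prod.inject surj_pair)
      have "B p \<subseteq> C h" "B q \<subseteq> C k"
        using pq by (auto simp: C_def)
      then show ?thesis
        using B(5)[of p q] pq(1) by (meson adj_def subsetD)
    qed
    ultimately show ?thesis
      unfolding branch_sets_def by blast
  qed
qed

lemma undominatedE:
  assumes "undominated V e" "x \<in> V" "y \<in> V" "z \<in> V" "y \<noteq> z" "e x y" "e x z"
  obtains u where "u \<in> V" "co e x u" "co e y u" "co e z u"
  using assms unfolding undominated_def by blast

text \<open>Let \<open>S\<close> be the branch set of a vertex of maximum degree in
  \<open>H\<close>. If this degree is at least n - 3, choosing one vertex in each neighbouring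
  branch set leaves at most three vertices for \<open>S\<close> and the remainder \<open>D\<close>
  together. A star on three vertices that contains \<open>S\<close> and dominates \<open>D\<close>
  dominates all of \<open>G\<close>, because the chosen vertices are adjacent to
  \<open>S\<close>.\<close>

lemma max_degree_minor_less:
  assumes G: "pair_graph G" and und: "undominated (pverts G) (adj G)"
    and n: "3 < card (pverts G)"
    and deg: "\<And>x. x \<in> pverts G \<Longrightarrow> 3 \<le> card {u. adj G x u} \<and> card {u. adj G x u} + 3 < card (pverts G)"
    and minor: "is_minor H G"
  shows "max_degree H + 3 < card (pverts G)"
proof (rule ccontr)
  let ?V = "pverts G"
  interpret sgraph ?V "adj G"
    using G by (rule sgraph_adj)
  assume large: "\<not> max_degree H + 3 < card ?V"
  have pH: "pair_graph H"
    using is_minor_pair_graph[OF minor G] .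
  obtain B where "branch_sets G H B"
    using minor_branch_sets[OF minor G] by blast
  note B = branch_setsD[OF this]
  have "max_degree H \<in> insert 0 (out_degree (with_proj H) ` pverts H)"
    unfolding max_degree_def using pH by (intro Max_in) (auto simp: pair_graph_iff)
  then obtain h where h: "h \<in> pverts H" "max_degree H = out_degree (with_proj H) h"
    using large n by auto
  define S where "S = B h"
  define K where "K = {k. adj H h k}"
  have K: "K \<subseteq> pverts H - {h}"
    using pH by (auto simp: K_def adj_def pair_graph_iff irrefl_def)
  have "\<forall>k\<in>K. \<exists>y. y \<in> B k \<and> (\<exists>x\<in>S. adj G x y)"
  proof
    fix k assume "k \<in> K"
    then show "\<exists>y. y \<in> B k \<and> (\<exists>x\<in>S. adj G x y)"
      using B(5)[of h k] unfolding K_def S_def by blast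
  qed
  then obtain y where y: "\<And>k. k \<in> K \<Longrightarrow> y k \<in> B k \<and> (\<exists>x\<in>S. adj G x (y k))"
    by metis
  have inj: "inj_on y K"
  proof (rule inj_onI, rule ccontr)
    fix k l assume kl: "k \<in> K" "l \<in> K" "y k = y l" "k \<noteq> l"
    then have "k \<in> pverts H" "l \<in> pverts H" "y k \<in> B k \<inter> B l"
      using y[of k] y[of l] K by auto
    then show False
      using B(4)[of k l] kl(4) by auto
  qed
  have S: "S \<subseteq> ?V" "S \<noteq> {}" "finite S"
    using B(1,2)[OF h(1)] finite_V by (auto simp: S_def intro: finite_subset)
  have yK: "y ` K \<subseteq> ?V" "y ` K \<inter> S = {}"
  proof -
    have "y k \<in> ?V \<and> y k \<notin> S" if "k \<in> K" for k
      using y[OF that] K B(2)[of k] B(4)[OF h(1), of k] that by (auto simp: S_def)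
    then show "y ` K \<subseteq> ?V" "y ` K \<inter> S = {}"
      by auto
  qed
  have "card (y ` K) = max_degree H"
    using card_image[OF inj] by (simp add: h(2) out_degree_pair K_def)
  with large have cY: "card ?V \<le> card (y ` K) + 3"
    by simp
  have adjY: "\<exists>x\<in>S. adj G x u" if "u \<in> y ` K" for u
    using that y by auto
  define D where "D = ?V - S - y ` K"
  have fY: "finite (y ` K)"
    using finite_V yK(1) by (rule finite_subset[rotated])
  have "card (S \<union> y ` K) = card S + card (y ` K)"
    using S(3) fY yK(2) by (intro card_Un_disjoint) auto
  moreover have "card (S \<union> y ` K) \<le> card ?V"
    using finite_V S(1) yK(1) by (intro card_mono) auto
  moreover have "D = ?V - (S \<union> y ` K)"
    by (auto simp: D_def)
  then have "card D = card ?V - card (S \<union> y ` K)"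
    using S fY yK(1) by (simp add: card_Diff_subset)
  ultimately have "card ?V = card S + card (y ` K) + card D"
    by simp
  then have cSD: "card S + card D \<le> 3"
    using cY by simp
  have fD: "finite D"
    using finite_V by (simp add: D_def)
  have no_dom: False
    if c: "adj G a b" "adj G a c" "b \<noteq> c" "S \<subseteq> {a, b, c}" "{a, b, c} \<subseteq> ?V"
      and d: "\<And>u. u \<in> D \<Longrightarrow> u \<notin> {a, b, c} \<Longrightarrow> adj G a u \<or> adj G b u \<or> adj G c u" for a b c
  proof -
    obtain u where u: "u \<in> ?V" "co (adj G) a u" "co (adj G) b u" "co (adj G) c u"
      using undominatedE[OF und, of a b c] c by blast
    show False
    proof (cases "u \<in> D")
      case True
      then show False
        using d[of u] u by (auto simp: co_def)
    next
      case False
      then have "u \<in> y ` K"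
        using u c(4) by (auto simp: co_def D_def)
      then show False
        using adjY[of u] u c(4) by (auto simp: co_def)
    qed
  qed
  consider x where "S = {x}" | x z where "S = {x, z}" "x \<noteq> z" |
      x z t where "S = {x, z, t}" "x \<noteq> z" "x \<noteq> t" "z \<noteq> t"
  proof -
    have "card S > 0"
      using S by (simp add: card_gt_0_iff)
    then have "card S = 1 \<or> card S = 2 \<or> card S = 3"
      using cSD by linarith
    then show thesis
    proof (elim disjE)
      assume "card S = 1"
      then show thesis
        using that(1) by (meson card_1_singletonE)
    next
      assume "card S = 2"
      then show thesis
        using that(2) by (meson card_2_iff)
    next
      assume "card S = 3"
      then show thesis
        using that(3) by (meson card_3_iff)
    qed
  qed
  then show False
  proof cases
    \<comment> \<open>A single vertex would itself have degree at least n - 3, against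
      \<open>deg\<close>.\<close>
    case (1 x)
    then have "y ` K \<subseteq> {u. adj G x u}"
      using adjY by auto
    moreover have "finite {u. adj G x u}"
      using G by (auto simp: pair_graph_iff adj_def intro: finite_subset[of _ ?V])
    ultimately have "card (y ` K) \<le> card {u. adj G x u}"
      by (rule card_mono[rotated])
    moreover have "x \<in> ?V"
      using S(1) 1 by simp
    ultimately show False
      using deg[of x] cY by linarith
  next
    case (2 x z)
    have "{x} \<union> {z} = S" "{x} \<inter> {z} = {}"
      using 2 by auto
    then have "\<exists>p\<in>{x}. \<exists>q\<in>{z}. adj G p q"
      using B(3)[OF h(1), folded S_def] unfolding cut_connected_def by (metis insert_not_empty)
    then have xz: "adj G x z" "adj G z x"
      using sym[of x z] by simp_all
    have "card D \<le> 1"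
      using cSD 2 by simp
    then have D1: "d = d'" if "d \<in> D" "d' \<in> D" for d d'
      using fD that card_le_Suc0_iff_eq by (metis One_nat_def)
    have "card (?V - S) > 0"
      using n 2 S by (simp add: card_Diff_subset)
    then obtain q where q: "q \<in> ?V - S"
      by (metis card_gt_0_iff equals0I)
    \<comment> \<open>\<open>p\<close> is the vertex of \<open>D\<close> if there is one, and any
      vertex outside \<open>S\<close> otherwise. Having three neighbours, it has one,
      \<open>t\<close>, outside \<open>S\<close>. Then \<open>t\<close> was chosen from a
      neighbouring branch set, hence is adjacent to \<open>x\<close> or \<open>z\<close>, and the
      star on \<open>x\<close>, \<open>z\<close>, \<open>t\<close> dominates \<open>p\<close> as
      well.\<close>
    obtain p where p: "p \<in> ?V - S" "D \<subseteq> {p}"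
    proof (cases "D = {}")
      case True
      with q show thesis
        using that by blast
    next
      case False
      then obtain d where "d \<in> D"
        by blast
      then show thesis
        using D1 that[of d] by (auto simp: D_def)
    qed
    have "\<not> {u. adj G p u} \<subseteq> {x, z}"
    proof
      assume "{u. adj G p u} \<subseteq> {x, z}"
      then have "card {u. adj G p u} \<le> card {x, z}"
        by (intro card_mono) auto
      then show False
        using deg[of p] p 2 by auto
    qed
    then obtain t where t: "adj G p t" "t \<notin> {x, z}"
      by auto
    have "t \<in> ?V" "t \<noteq> p" "adj G t p"
      using t(1) G sym[of p t] irrefl[of p] by (auto simp: adj_def pair_graph_iff)
    then have "t \<in> y ` K"
      using t p 2 by (auto simp: D_def)
    then have "adj G x t \<or> adj G z t"
      using adjY 2 by auto
    then show False
      using no_dom[of x z t] no_dom[of z x t] xz t p 2 S \<open>t \<in> ?V\<close> \<open>adj G t p\<close> by auto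
  next
    \<comment> \<open>Nothing is left over, and a connected set of three vertices is itself a
      star.\<close>
    case (3 x z t)
    then have "D = {}"
      using cSD fD by simp
    have c: "\<exists>p\<in>P. \<exists>q\<in>Q. adj G p q" if "P \<union> Q = S" "P \<inter> Q = {}" "P \<noteq> {}" "Q \<noteq> {}" for P Q
      using B(3)[OF h(1), folded S_def] that unfolding cut_connected_def by blast
    have "adj G x z \<or> adj G x t" "adj G z x \<or> adj G z t" "adj G t x \<or> adj G t z"
      using c[of "{x}" "{z, t}"] c[of "{z}" "{x, t}"] c[of "{t}" "{x, z}"] 3 by auto
    then show False
      using no_dom[of x z t] no_dom[of z x t] no_dom[of t x z] 3 S \<open>D = {}\<close>
        sym[of x z] sym[of z x] sym[of x t] sym[of t x] sym[of z t] sym[of t z] by auto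
  qed
qed

section \<open>Degrees\<close>

locale nc_graph = sgraph +
  assumes undominated: "undominated V e" and undominated_co: "undominated V (co e)"
begin

lemma nc_graph_co: "nc_graph V (co e)"
  using sgraph_co undominated undominated_co by (auto simp: nc_graph_def nc_graph_axioms_def co_co)

definition N :: "'a \<Rightarrow> 'a set" where "N v = {u \<in> V. e v u}"
definition M :: "'a \<Rightarrow> 'a set" where "M v = {u \<in> V. co e v u}"

lemma N_co: "nc_graph.N V (co e) v = M v" and M_co: "nc_graph.M V (co e) v = N v"
  using nc_graph_co by (simp_all add: nc_graph.N_def nc_graph.M_def M_def N_def co_co)

lemma finite_N [simp]: "finite (N v)" and finite_M [simp]: "finite (M v)"
  using finite_V by (simp_all add: N_def M_def)

lemma card_N_M: "v \<in> V \<Longrightarrow> card (N v) + card (M v) + 1 = card V"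
proof -
  assume "v \<in> V"
  then have "V = insert v (N v \<union> M v)" "v \<notin> N v \<union> M v" "N v \<inter> M v = {}"
    using irrefl by (auto simp: N_def M_def co_def)
  then show ?thesis
    using card_Un_disjoint[of "N v" "M v"] by (metis Suc_eq_plus1 card_insert_disjoint finite_M finite_N finite_Un)
qed

lemma common_nonneighbour:
  assumes "v \<in> V" "a \<in> N v" "a' \<in> N v" "a \<noteq> a'"
  obtains b where "b \<in> M v" "\<not> e a b" "\<not> e a' b"
proof -
  have "a \<in> V" "a' \<in> V" "e v a" "e v a'"
    using assms by (auto simp: N_def)
  then obtain b where "b \<in> V" "co e v b" "co e a b" "co e a' b"
    using undominatedE[OF undominated assms(1)] assms(4) by blast
  then show thesis
    using that[of b] by (simp add: M_def co_def)
qed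

lemma common_neighbour:
  assumes "v \<in> V" "b \<in> M v" "b' \<in> M v" "b \<noteq> b'"
  obtains a where "a \<in> N v" "e a b" "e a b'"
proof -
  obtain a where "a \<in> V" "e v a" "e b a" "e b' a"
    using undominatedE[OF undominated_co, of v b b'] assms unfolding M_def co_co by auto
  then show thesis
    using that[of a] sym[of b a] sym[of b' a] by (simp add: N_def)
qed

text \<open>If \<open>N b \<inter> N v\<close> had at most two elements, it would be contained in a pair, and the set
  \<open>N b' \<inter> N v\<close> that misses this pair would be disjoint from it.\<close>

lemma card_N_Int_N:
  assumes v: "v \<in> V" and b: "b \<in> M v" and "2 \<le> card (N v)" "2 \<le> card (M v)"
  shows "3 \<le> card (N b \<inter> N v)"
proof (rule ccontr)
  assume "\<not> 3 \<le> card (N b \<inter> N v)"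
  then obtain P where P: "N b \<inter> N v \<subseteq> P" "P \<subseteq> N v" "card P = 2"
    using exists_subset_between[of "N b \<inter> N v" 2 "N v"] assms(3) by auto
  then obtain a a' where a: "P = {a, a'}" "a \<noteq> a'"
    by (auto simp: card_2_iff)
  obtain b' where b': "b' \<in> M v" "\<not> e a b'" "\<not> e a' b'"
    using common_nonneighbour[of v a a'] v P a by auto
  obtain b'' where b'': "b'' \<in> M v" "b \<noteq> b''"
  proof -
    have "M v \<noteq> {b}"
      using assms(4) by auto
    then show ?thesis
      using b that by blast
  qed
  obtain c where c: "c \<in> N v" "e c b" "e c b'"
    using common_neighbour[OF v b b'(1)] common_neighbour[OF v b b''(1)] b'' by metis
  then have "c \<in> P"
    using P(1) sym[of c b] unfolding N_def by auto
  then show False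
    using a b' c by auto
qed

text \<open>This is \<open>card_N_Int_N\<close> in the complement, where \<open>N\<close> and
  \<open>M\<close> change places: \<open>a\<close> misses at least three vertices of
  \<open>M v\<close>.\<close>

lemma card_N_Int_N_le:
  assumes v: "v \<in> V" and a: "a \<in> N v" and "2 \<le> card (N v)" "2 \<le> card (M v)"
  shows "card (N a \<inter> M v) + 3 \<le> card (M v)"
proof -
  interpret c: nc_graph V "co e"
    by (rule nc_graph_co)
  have "3 \<le> card (M a \<inter> M v)"
    using c.card_N_Int_N[of v a] assms by (simp add: N_co M_co)
  moreover have "M v = (N a \<inter> M v) \<union> (M a \<inter> M v)" "(N a \<inter> M v) \<inter> (M a \<inter> M v) = {}"
    using a irrefl by (auto simp: N_def M_def co_def)
  then have "card (M v) = card (N a \<inter> M v) + card (M a \<inter> M v)"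
    by (metis card_Un_disjoint finite_Int finite_M)
  ultimately show ?thesis
    by simp
qed

text \<open>Every non-neighbour of \<open>v\<close> has at least three neighbours in
  \<open>N v\<close>, whereas each pair in \<open>N v\<close> is missed by some non-neighbour; so
  \<open>N v\<close> has at least five elements. If it had exactly five, the ten complements of
  pairs would all be traces of distinct non-neighbours, of which there are at most eight.\<close>

lemma card_N_ge_6:
  assumes v: "v \<in> V" and V: "card V \<in> {13, 14}"
  shows "6 \<le> card (N v)"
proof (rule ccontr)
  assume small: "\<not> 6 \<le> card (N v)"
  then have M: "7 \<le> card (M v)" "card (M v) + card (N v) \<le> 13"
    using card_N_M[OF v] V by auto
  obtain b b' where b: "b \<in> M v" "b' \<in> M v" "b \<noteq> b'"
    using M(1) card_le_Suc0_iff_eq[OF finite_M, of v] by force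
  obtain a where a: "a \<in> N v" "e a b" "e a b'"
    using common_neighbour[OF v b] .
  show False
  proof (cases "card (N v) = 1")
    \<comment> \<open>The only neighbour \<open>a\<close> must serve all pairs in
      \<open>M v\<close>, so it is adjacent to all of \<open>M v\<close>, and the star with centre
      \<open>a\<close> and leaves \<open>v\<close>, \<open>b\<close> dominates the graph.\<close>
    case True
    then have N: "N v = {a}"
      using a(1) by (auto simp: card_1_singleton_iff)
    have all: "e a c" if c: "c \<in> M v" for c
    proof -
      obtain d where d: "d \<in> M v" "c \<noteq> d"
        using b by metis
      obtain a' where "a' \<in> N v" "e a' c"
        using common_neighbour[OF v c d] .
      then show ?thesis
        using N by simp
    qed
    have "a \<in> V" "b \<in> V" "v \<noteq> b" "e a v"
      using a b sym[of v a] by (auto simp: N_def M_def co_def)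
    then obtain u where "u \<in> V" "co e a u" "co e v u"
      using undominatedE[OF undominated, of a v b] v a(2) by metis
    then show False
      using all[of u] unfolding M_def co_def by simp
  next
    case False
    moreover have "card (N v) \<noteq> 0"
      using a(1) by auto
    ultimately have N2: "2 \<le> card (N v)"
      by linarith
    \<comment> \<open>The trace avoids \<open>P\<close>, and among five neighbours this leaves room
      for exactly the three elements that \<open>card_N_Int_N\<close> demands.\<close>
    have *: "\<exists>b\<in>M v. N b \<inter> N v = N v - P" if P: "P \<subseteq> N v" "card P = 2" and N5: "card (N v) = 5" for P
    proof -
      obtain p p' where p: "P = {p, p'}" "p \<noteq> p'"
        using P by (auto simp: card_2_iff)
      obtain b where b: "b \<in> M v" "\<not> e p b" "\<not> e p' b"
        using common_nonneighbour[of v p p'] v p P by auto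
      have "N b \<inter> N v \<subseteq> N v - P"
        using b p sym[of b p] sym[of b p'] by (auto simp: N_def)
      moreover have "card (N v - P) \<le> card (N b \<inter> N v)"
        using card_N_Int_N[OF v b(1) N2] M(1) P N5 by (simp add: card_Diff_subset finite_subset[OF P(1)])
      ultimately show ?thesis
        using b(1) by (metis card_seteq finite_Diff finite_N)
    qed
    have "5 \<le> card (N v)"
    proof -
      obtain p p' where p: "p \<in> N v" "p' \<in> N v" "p \<noteq> p'"
        using N2 card_le_Suc0_iff_eq[OF finite_N, of v] by force
      obtain b where b: "b \<in> M v" "\<not> e p b" "\<not> e p' b"
        using common_nonneighbour[OF v p] .
      have "N b \<inter> N v \<subseteq> N v - {p, p'}"
        using b sym[of b p] sym[of b p'] by (auto simp: N_def)
      then have "card (N b \<inter> N v) \<le> card (N v - {p, p'})"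
        by (intro card_mono) auto
      then show ?thesis
        using card_N_Int_N[OF v b(1) N2] M p by (simp add: card_Diff_subset)
    qed
    with small have N5: "card (N v) = 5"
      by simp
    let ?Ps = "{P. P \<subseteq> N v \<and> card P = 2}"
    have "\<forall>P\<in>?Ps. \<exists>b. b \<in> M v \<and> N b \<inter> N v = N v - P"
      using *[OF _ _ N5] by blast
    then obtain f where f: "\<forall>P\<in>?Ps. f P \<in> M v \<and> N (f P) \<inter> N v = N v - P"
      by (rule bchoice[THEN exE])
    have "inj_on f ?Ps"
    proof (rule inj_onI)
      fix P Q assume PQ: "P \<in> ?Ps" "Q \<in> ?Ps" "f P = f Q"
      then have "N v - P = N v - Q"
        using f[rule_format, OF PQ(1)] f[rule_format, OF PQ(2)] by simp
      then show "P = Q"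
        using PQ(1,2) by blast
    qed
    then have "card ?Ps \<le> card (M v)"
      using f by (intro card_inj_on_le[of f]) auto
    moreover have "card ?Ps = 5 choose 2"
      using n_subsets[OF finite_N, of v 2] N5 by simp
    ultimately show False
      using M N5 by (simp add: numeral_eq_Suc)
  qed
qed

lemma card_M_ge_6:
  assumes v: "v \<in> V" and V: "card V \<in> {13, 14}"
  shows "6 \<le> card (M v)"
proof -
  interpret c: nc_graph V "co e"
    by (rule nc_graph_co)
  show ?thesis
    using c.card_N_ge_6[OF v V] by (simp add: N_co)
qed

end

section \<open>Adjacency matrices with Boolean entries\<close>

fun all_pairs :: "('a \<Rightarrow> 'a \<Rightarrow> bool) \<Rightarrow> 'a list \<Rightarrow> bool" where
  "all_pairs P [] = True"
| "all_pairs P (x # xs) = (list_all (P x) xs \<and> all_pairs P xs)"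

fun all_triples :: "('a \<Rightarrow> 'a \<Rightarrow> 'a \<Rightarrow> bool) \<Rightarrow> 'a list \<Rightarrow> bool" where
  "all_triples P [] = True"
| "all_triples P (x # xs) = (all_pairs (P x) xs \<and> all_triples P xs)"

fun meet2 :: "bool list \<Rightarrow> bool list \<Rightarrow> bool" where
  "meet2 (x # xs) (y # ys) = (x \<and> y \<or> meet2 xs ys)"
| "meet2 _ _ = False"

fun meet3 :: "bool list \<Rightarrow> bool list \<Rightarrow> bool list \<Rightarrow> bool" where
  "meet3 (x # xs) (y # ys) (z # zs) = (x \<and> y \<and> z \<or> meet3 xs ys zs)"
| "meet3 _ _ _ = False"

text \<open>A vertex is represented by its number and by its rows in the adjacency matrices of the
  graph and of the complement.\<close>

fun rows :: "nat \<Rightarrow> bool list list \<Rightarrow> (nat \<times> bool list \<times> bool list) list" where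
  "rows i [] = []"
| "rows i (r # M) = (i, r, (map Not r)[i := False]) # rows (Suc i) M"

text \<open>The premises say that at least two of the pairs ij, ik, jk are joined. This covers every
  choice of the centre, so it suffices to test each unordered triple once.\<close>

definition row_triple where
  "row_triple = (\<lambda>(i, r, c) (j, r', c') (k, r'', c'').
     (r ! j \<and> r ! k \<or> r ! j \<and> r' ! k \<or> r ! k \<and> r' ! k \<longrightarrow> meet3 c c' c'') \<and>
     (c ! j \<and> c ! k \<or> c ! j \<and> c' ! k \<or> c ! k \<and> c' ! k \<longrightarrow> meet3 r r' r''))"

text \<open>The two vertices are not twins. Each vertex has False at its own position in both of its
  rows, so the separating column is a third vertex.\<close>

definition row_distinct where
  "row_distinct = (\<lambda>(i, r, c) (j, r', c'). meet2 r c' \<or> meet2 c r')"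

text \<open>Only values \<open>e i j\<close> with i < j occur. Unfolding thus leaves one
  propositional atom for each unordered pair, with symmetry and irreflexivity built in.\<close>

definition adj_matrix :: "nat \<Rightarrow> (nat \<Rightarrow> nat \<Rightarrow> bool) \<Rightarrow> bool list list" where
  "adj_matrix n e =
     map (\<lambda>i. map (\<lambda>j. if i < j then e i j else if j < i then e j i else False) [0..<n]) [0..<n]"

fun code :: "bool list \<Rightarrow> nat" where
  "code [] = 0"
| "code (x # xs) = of_bool x * 2 ^ length xs + code xs"

text \<open>The propositional counterpart of comparing values of \<open>code\<close>: sorting uses
  numbers, the solver needs Boolean formulas.\<close>

fun lex_ge :: "bool list \<Rightarrow> bool list \<Rightarrow> bool" where
  "lex_ge (x # xs) (y # ys) = ((y \<longrightarrow> x) \<and> (x \<and> \<not> y \<or> lex_ge xs ys))"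
| "lex_ge _ _ = True"

lemma code_3:
  "code [x, y, z] = 0 \<longleftrightarrow> \<not> x \<and> \<not> y \<and> \<not> z"
  "code [x, y, z] = 1 \<longleftrightarrow> \<not> x \<and> \<not> y \<and> z"
  "code [x, y, z] = 2 \<longleftrightarrow> \<not> x \<and> y \<and> \<not> z"
  "code [x, y, z] = 3 \<longleftrightarrow> \<not> x \<and> y \<and> z"
  "code [x, y, z] = 4 \<longleftrightarrow> x \<and> \<not> y \<and> \<not> z"
  "code [x, y, z] = 5 \<longleftrightarrow> x \<and> \<not> y \<and> z"
  "code [x, y, z] = 6 \<longleftrightarrow> x \<and> y \<and> \<not> z"
  "code [x, y, z] = 7 \<longleftrightarrow> x \<and> y \<and> z"
  by (cases x; cases y; cases z; simp)+

lemma upt_14: "[0..<14] = [0, 1, 2, 3, 4, 5, 6, 7, 8, 9, 10, 11, 12, 13]"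
  and upt_13: "[0..<13] = [0, 1, 2, 3, 4, 5, 6, 7, 8, 9, 10, 11, 12]"
  and upt_1_7: "[1..<7] = [1, 2, 3, 4, 5, 6]"
  and upt_7_14: "[7..<14] = [7, 8, 9, 10, 11, 12, 13]"
  and upt_7_13: "[7..<13] = [7, 8, 9, 10, 11, 12]"
  by (simp_all add: upt_rec)

lemmas upts = upt_14 upt_13 upt_1_7 upt_7_14 upt_7_13

lemmas expand_simps = all_triples.simps all_pairs.simps list.pred_inject rows.simps list.map
  list_update_code nth_Cons_0 nth_Cons_Suc prod.case meet2.simps meet3.simps row_triple_def
  row_distinct_def simp_thms de_Morgan_disj de_Morgan_conj

text \<open>The columns, read as binary numbers and sorted decreasingly, of the 3 x 7 matrices with
  four ones in each row and a common zero of any two rows.\<close>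

definition column_patterns :: "nat list list" where
  "column_patterns = [
     [6, 6, 5, 5, 3, 3, 0], [7, 6, 5, 4, 3, 2, 1], [7, 6, 5, 4, 3, 3, 0], [7, 6, 5, 5, 3, 2, 0],
     [7, 6, 6, 5, 3, 1, 0], [7, 7, 4, 4, 3, 2, 1], [7, 7, 4, 4, 3, 3, 0], [7, 7, 5, 4, 2, 2, 1],
     [7, 7, 5, 4, 3, 2, 0], [7, 7, 5, 5, 2, 2, 0], [7, 7, 6, 4, 2, 1, 1], [7, 7, 6, 4, 3, 1, 0],
     [7, 7, 6, 5, 2, 1, 0], [7, 7, 6, 5, 3, 0, 0], [7, 7, 6, 6, 1, 1, 0], [7, 7, 7, 4, 2, 1, 0],
     [7, 7, 7, 4, 3, 0, 0], [7, 7, 7, 5, 2, 0, 0], [7, 7, 7, 6, 1, 0, 0], [7, 7, 7, 7, 0, 0, 0]]"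

lemma all_pairsI:
  assumes "\<And>i j. i < j \<Longrightarrow> j < length xs \<Longrightarrow> P (xs ! i) (xs ! j)"
  shows "all_pairs P xs"
  using assms
proof (induction xs)
  case (Cons x xs)
  have "all_pairs P xs"
    using Cons.IH Cons.prems[of "Suc i" "Suc j" for i j] by simp
  moreover have "P x (xs ! j)" if "j < length xs" for j
    using Cons.prems[of 0 "Suc j"] that by simp
  ultimately show ?case
    by (auto simp: list_all_length)
qed simp

lemma all_triplesI:
  assumes "\<And>i j k. i < j \<Longrightarrow> j < k \<Longrightarrow> k < length xs \<Longrightarrow> P (xs ! i) (xs ! j) (xs ! k)"
  shows "all_triples P xs"
  using assms
proof (induction xs)
  case (Cons x xs)
  have "all_triples P xs"
    using Cons.IH Cons.prems[of "Suc i" "Suc j" "Suc k" for i j k] by simp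
  moreover have "all_pairs (P x) xs"
    using Cons.prems[of 0 "Suc j" "Suc k" for j k] by (intro all_pairsI) simp
  ultimately show ?case
    by simp
qed simp

lemma length_rows [simp]: "length (rows i M) = length M"
  by (induction M arbitrary: i) auto

lemma nth_rows: "k < length M \<Longrightarrow> rows i M ! k = (i + k, M ! k, (map Not (M ! k))[i + k := False])"
proof (induction M arbitrary: i k)
  case (Cons r M)
  then show ?case
    by (cases k) auto
qed simp

lemma meet2I: "length ys = length xs \<Longrightarrow> u < length xs \<Longrightarrow> xs ! u \<Longrightarrow> ys ! u \<Longrightarrow> meet2 xs ys"
proof (induction xs ys arbitrary: u rule: meet2.induct)
  case (1 x xs y ys)
  then show ?case
    by (cases u) auto
qed auto

lemma meet3I:
  "length ys = length xs \<Longrightarrow> length zs = length xs \<Longrightarrow> u < length xs \<Longrightarrow>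
     xs ! u \<Longrightarrow> ys ! u \<Longrightarrow> zs ! u \<Longrightarrow> meet3 xs ys zs"
proof (induction xs ys zs arbitrary: u rule: meet3.induct)
  case (1 x xs y ys z zs)
  then show ?case
    by (cases u) auto
qed auto

section \<open>Matrices of graphs with listed vertices\<close>

definition twins :: "'a set \<Rightarrow> ('a \<Rightarrow> 'a \<Rightarrow> bool) \<Rightarrow> 'a \<Rightarrow> 'a \<Rightarrow> bool" where
  "twins V e x y \<longleftrightarrow> x \<in> V \<and> y \<in> V \<and> x \<noteq> y \<and> (\<forall>u\<in>V - {x, y}. e x u = e y u)"

locale listed_sgraph = sgraph +
  fixes L :: "'a list"
  assumes distinct_L: "distinct L" and set_L: "set L = V"
begin

abbreviation E :: "nat \<Rightarrow> nat \<Rightarrow> bool" where "E i j \<equiv> e (L ! i) (L ! j)"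

lemma nth_in_V: "i < length L \<Longrightarrow> L ! i \<in> V"
  using set_L by auto

lemma in_V_nth: "x \<in> V \<Longrightarrow> \<exists>i<length L. x = L ! i"
  using set_L by (metis in_set_conv_nth)

lemma co_nth: "i < length L \<Longrightarrow> j < length L \<Longrightarrow> co e (L ! i) (L ! j) \<longleftrightarrow> i \<noteq> j \<and> \<not> E i j"
  using distinct_L by (simp add: co_def nth_eq_iff_index_eq)

lemma e_commute: "e x y = e y x"
  using sym by blast

lemma adj_matrix_nth:
  assumes "i < length L" "j < length L"
  shows "adj_matrix (length L) E ! i ! j = E i j"
proof (cases i j rule: linorder_cases)
  case equal
  then show ?thesis
    using assms irrefl by (simp add: adj_matrix_def)
qed (use assms e_commute in \<open>auto simp: adj_matrix_def\<close>)

lemma length_adj_matrix: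
  "length (adj_matrix n f) = n" "i < n \<Longrightarrow> length (adj_matrix n f ! i) = n"
  by (simp_all add: adj_matrix_def)

lemma rows_nth:
  assumes "i < length L"
  shows "\<exists>r c. rows 0 (adj_matrix (length L) E) ! i = (i, r, c) \<and> length r = length L \<and> length c = length L \<and>
    (\<forall>j<length L. (r ! j \<longleftrightarrow> E i j) \<and> (c ! j \<longleftrightarrow> co e (L ! i) (L ! j)))"
proof (intro exI conjI)
  let ?r = "adj_matrix (length L) E ! i"
  let ?c = "(map Not ?r)[i := False]"
  show "rows 0 (adj_matrix (length L) E) ! i = (i, ?r, ?c)"
    using nth_rows[of i "adj_matrix (length L) E" 0] assms by (simp add: length_adj_matrix)
  show "length ?r = length L" "length ?c = length L"
    using assms by (simp_all add: length_adj_matrix)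
  show "\<forall>j<length L. (?r ! j \<longleftrightarrow> E i j) \<and> (?c ! j \<longleftrightarrow> co e (L ! i) (L ! j))"
    using assms by (auto simp: length_adj_matrix adj_matrix_nth co_nth nth_list_update)
qed

lemma row_distinct_if_not_twins:
  assumes ij: "i < length L" "j < length L" "i \<noteq> j" and "\<not> twins V e (L ! i) (L ! j)"
  shows "row_distinct (rows 0 (adj_matrix (length L) E) ! i) (rows 0 (adj_matrix (length L) E) ! j)"
proof -
  obtain r c where i: "rows 0 (adj_matrix (length L) E) ! i = (i, r, c)" "length r = length L" "length c = length L"
    "\<forall>j<length L. (r ! j \<longleftrightarrow> E i j) \<and> (c ! j \<longleftrightarrow> co e (L ! i) (L ! j))"
    using rows_nth[OF ij(1)] by blast
  obtain r' c' where j: "rows 0 (adj_matrix (length L) E) ! j = (j, r', c')" "length r' = length L" "length c' = length L"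
    "\<forall>k<length L. (r' ! k \<longleftrightarrow> E j k) \<and> (c' ! k \<longleftrightarrow> co e (L ! j) (L ! k))"
    using rows_nth[OF ij(2)] by blast
  have "L ! i \<noteq> L ! j"
    using ij distinct_L by (simp add: nth_eq_iff_index_eq)
  then obtain u where u: "u \<in> V" "u \<noteq> L ! i" "u \<noteq> L ! j" "e (L ! i) u \<noteq> e (L ! j) u"
    using assms nth_in_V unfolding twins_def by blast
  then obtain k where k: "k < length L" "u = L ! k"
    using in_V_nth by blast
  then have "k \<noteq> i" "k \<noteq> j"
    using u by auto
  then have "(r ! k \<and> c' ! k) \<or> (c ! k \<and> r' ! k)"
    using u k i(4) j(4) ij co_nth by auto
  then show ?thesis
    unfolding i(1) j(1) row_distinct_def prod.case
    using meet2I[of c' r k] meet2I[of r' c k] k i j by auto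
qed

end

locale listed_nc_graph = nc_graph + listed_sgraph
begin

lemma all_triples_rows: "all_triples row_triple (rows 0 (adj_matrix (length L) E))"
proof (rule all_triplesI)
  fix i j k assume ijk: "i < j" "j < k" "k < length (rows 0 (adj_matrix (length L) E))"
  then have lt: "i < length L" "j < length L" "k < length L"
    by (auto simp: length_adj_matrix)
  obtain r c where i: "rows 0 (adj_matrix (length L) E) ! i = (i, r, c)" "length r = length L" "length c = length L"
    "\<forall>j<length L. (r ! j \<longleftrightarrow> E i j) \<and> (c ! j \<longleftrightarrow> co e (L ! i) (L ! j))"
    using rows_nth[OF lt(1)] by blast
  obtain r' c' where j: "rows 0 (adj_matrix (length L) E) ! j = (j, r', c')" "length r' = length L" "length c' = length L"
    "\<forall>k<length L. (r' ! k \<longleftrightarrow> E j k) \<and> (c' ! k \<longleftrightarrow> co e (L ! j) (L ! k))"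
    using rows_nth[OF lt(2)] by blast
  obtain r'' c'' where k: "rows 0 (adj_matrix (length L) E) ! k = (k, r'', c'')" "length r'' = length L" "length c'' = length L"
    "\<forall>j<length L. (r'' ! j \<longleftrightarrow> E k j) \<and> (c'' ! j \<longleftrightarrow> co e (L ! k) (L ! j))"
    using rows_nth[OF lt(3)] by blast
  \<comment> \<open>The relation \<open>f\<close> is left open because the claim is applied to the
    graph and to its complement.\<close>
  have star: "\<exists>u<length L. co f (L ! i) (L ! u) \<and> co f (L ! j) (L ! u) \<and> co f (L ! k) (L ! u)"
    if f: "undominated V f" "f (L ! i) (L ! j) \<and> f (L ! i) (L ! k) \<or> f (L ! j) (L ! i) \<and> f (L ! j) (L ! k) \<or>
      f (L ! k) (L ! i) \<and> f (L ! k) (L ! j)" for f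
  proof -
    have ne: "L ! i \<noteq> L ! j" "L ! i \<noteq> L ! k" "L ! j \<noteq> L ! k"
      using ijk lt distinct_L by (simp_all add: nth_eq_iff_index_eq)
    have "\<exists>u\<in>V. co f (L ! i) u \<and> co f (L ! j) u \<and> co f (L ! k) u"
      using f(2)
    proof (elim disjE conjE)
      assume "f (L ! i) (L ! j)" "f (L ! i) (L ! k)"
      then show ?thesis
        using undominatedE[OF f(1), of "L ! i" "L ! j" "L ! k"] nth_in_V lt ne by metis
    next
      assume "f (L ! j) (L ! i)" "f (L ! j) (L ! k)"
      then show ?thesis
        using undominatedE[OF f(1), of "L ! j" "L ! i" "L ! k"] nth_in_V lt ne by metis
    next
      assume "f (L ! k) (L ! i)" "f (L ! k) (L ! j)"
      then show ?thesis
        using undominatedE[OF f(1), of "L ! k" "L ! i" "L ! j"] nth_in_V lt ne by metis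
    qed
    then show ?thesis
      using in_V_nth by metis
  qed
  have "meet3 c c' c''" if h: "r ! j \<and> r ! k \<or> r ! j \<and> r' ! k \<or> r ! k \<and> r' ! k"
  proof -
    have "E i j \<and> E i k \<or> E j i \<and> E j k \<or> E k i \<and> E k j"
      using h i(4) j(4) lt e_commute[of "L ! j" "L ! i"] e_commute[of "L ! k" "L ! i"] e_commute[of "L ! k" "L ! j"]
      by simp
    from star[OF undominated this] obtain u where "u < length L" "c ! u" "c' ! u" "c'' ! u"
      using i(4) j(4) k(4) by blast
    then show ?thesis
      using meet3I[of c' c c'' u] i j k by simp
  qed
  moreover have "meet3 r r' r''" if h: "c ! j \<and> c ! k \<or> c ! j \<and> c' ! k \<or> c ! k \<and> c' ! k"
  proof -
    have com: "co e x y = co e y x" for x y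
      using e_commute by (auto simp: co_def)
    have "co e (L ! i) (L ! j) \<and> co e (L ! i) (L ! k) \<or> co e (L ! j) (L ! i) \<and> co e (L ! j) (L ! k) \<or>
        co e (L ! k) (L ! i) \<and> co e (L ! k) (L ! j)"
      using h i(4) j(4) lt com[of "L ! j" "L ! i"] com[of "L ! k" "L ! i"] com[of "L ! k" "L ! j"] by simp
    from star[OF undominated_co this] obtain u where "u < length L" "r ! u" "r' ! u" "r'' ! u"
      unfolding co_co using i(4) j(4) k(4) by blast
    then show ?thesis
      using meet3I[of r' r r'' u] i j k by simp
  qed
  ultimately show "row_triple (rows 0 (adj_matrix (length L) E) ! i) (rows 0 (adj_matrix (length L) E) ! j)
      (rows 0 (adj_matrix (length L) E) ! k)"
    unfolding i(1) j(1) k(1) row_triple_def prod.case by blast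
qed

end

text \<open>The neighbours of vertex 0 and one column pattern determine 13 + 21 of the 91 entries;
  the remaining 57 are the unknowns of each of the twenty refutations. The absence of twins,
  \<open>tw\<close>, is essential: without it the two twin extensions of the Paley graph satisfy the
  constraints on triples.\<close>

lemma no_column_pattern:
  assumes nc: "all_triples row_triple (rows 0 (adj_matrix 14 e))"
    and tw: "all_pairs row_distinct (rows 0 (adj_matrix 14 e))"
    and v: "list_all (e 0) [1..<7]" "list_all (\<lambda>i. \<not> e 0 i) [7..<14]"
  shows "map (\<lambda>b. code [e 1 b, e 2 b, e 3 b]) [7..<14] \<notin> set column_patterns"
proof
  note [[argo_timeout = 600]]
  let ?cols = "map (\<lambda>b. code [e 1 b, e 2 b, e 3 b]) [7..<14]"
  note V = v[unfolded upts, simplified]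
  note M = adj_matrix_def[of 14 e, unfolded upts list.map, simplified, simplified V]
  \<comment> \<open>The entries of vertex 0 are substituted before the constraints are expanded,
    those of the column pattern afterwards, so that the expansion is shared by all cases.\<close>
  note F = nc[unfolded M expand_simps] tw[unfolded M expand_simps]
  \<comment> \<open>\<open>One_nat_def\<close> gives the atoms of the pattern the form
    \<open>e (Suc 0) b\<close>, which simplification has produced in the matrix; otherwise they
    would not match.\<close>
  note P = upts list.map list.inject code_3 One_nat_def simp_thms
  have p1: False if "?cols = [6, 6, 5, 5, 3, 3, 0]"
    using F[simplified that[unfolded P] simp_thms] by (elim conjE) argo
  have p2: False if "?cols = [7, 6, 5, 4, 3, 2, 1]"
    using F[simplified that[unfolded P] simp_thms] by (elim conjE) argo
  have p3: False if "?cols = [7, 6, 5, 4, 3, 3, 0]"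
    using F[simplified that[unfolded P] simp_thms] by (elim conjE) argo
  have p4: False if "?cols = [7, 6, 5, 5, 3, 2, 0]"
    using F[simplified that[unfolded P] simp_thms] by (elim conjE) argo
  have p5: False if "?cols = [7, 6, 6, 5, 3, 1, 0]"
    using F[simplified that[unfolded P] simp_thms] by (elim conjE) argo
  have p6: False if "?cols = [7, 7, 4, 4, 3, 2, 1]"
    using F[simplified that[unfolded P] simp_thms] by (elim conjE) argo
  have p7: False if "?cols = [7, 7, 4, 4, 3, 3, 0]"
    using F[simplified that[unfolded P] simp_thms] by (elim conjE) argo
  have p8: False if "?cols = [7, 7, 5, 4, 2, 2, 1]"
    using F[simplified that[unfolded P] simp_thms] by (elim conjE) argo
  have p9: False if "?cols = [7, 7, 5, 4, 3, 2, 0]"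
    using F[simplified that[unfolded P] simp_thms] by (elim conjE) argo
  have p10: False if "?cols = [7, 7, 5, 5, 2, 2, 0]"
    using F[simplified that[unfolded P] simp_thms] by (elim conjE) argo
  have p11: False if "?cols = [7, 7, 6, 4, 2, 1, 1]"
    using F[simplified that[unfolded P] simp_thms] by (elim conjE) argo
  have p12: False if "?cols = [7, 7, 6, 4, 3, 1, 0]"
    using F[simplified that[unfolded P] simp_thms] by (elim conjE) argo
  have p13: False if "?cols = [7, 7, 6, 5, 2, 1, 0]"
    using F[simplified that[unfolded P] simp_thms] by (elim conjE) argo
  have p14: False if "?cols = [7, 7, 6, 5, 3, 0, 0]"
    using F[simplified that[unfolded P] simp_thms] by (elim conjE) argo
  have p15: False if "?cols = [7, 7, 6, 6, 1, 1, 0]"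
    using F[simplified that[unfolded P] simp_thms] by (elim conjE) argo
  have p16: False if "?cols = [7, 7, 7, 4, 2, 1, 0]"
    using F[simplified that[unfolded P] simp_thms] by (elim conjE) argo
  have p17: False if "?cols = [7, 7, 7, 4, 3, 0, 0]"
    using F[simplified that[unfolded P] simp_thms] by (elim conjE) argo
  have p18: False if "?cols = [7, 7, 7, 5, 2, 0, 0]"
    using F[simplified that[unfolded P] simp_thms] by (elim conjE) argo
  have p19: False if "?cols = [7, 7, 7, 6, 1, 0, 0]"
    using F[simplified that[unfolded P] simp_thms] by (elim conjE) argo
  have p20: False if "?cols = [7, 7, 7, 7, 0, 0, 0]"
    using F[simplified that[unfolded P] simp_thms] by (elim conjE) argo
  assume "?cols \<in> set column_patterns"
  then show False
    unfolding column_patterns_def list.set insert_iff empty_iff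
    using p1 p2 p3 p4 p5 p6 p7 p8 p9 p10 p11 p12 p13 p14 p15 p16 p17 p18 p19 p20 by sat
qed

text \<open>The listed residues are the nonzero squares modulo 13. The relation is defined on all
  integers, so that it is invariant under translations without side conditions.\<close>

definition paley_13 :: "int \<Rightarrow> int \<Rightarrow> bool" where
  "paley_13 x y \<longleftrightarrow> (x - y) mod 13 \<in> {1, 3, 4, 9, 10, 12}"

text \<open>The two labellings of the Paley graph that meet the normalisation of the vertex order in
  the next lemma.\<close>

definition paley_order1 :: "int list" where
  "paley_order1 = [0, 1, 10, 9, 12, 4, 3, 11, 5, 2, 6, 7, 8]"

definition paley_order2 :: "int list" where
  "paley_order2 = [0, 1, 4, 3, 12, 10, 9, 5, 2, 11, 7, 8, 6]"

abbreviation paley_matrix :: "int list \<Rightarrow> bool list list" where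
  "paley_matrix p \<equiv> adj_matrix 13 (\<lambda>i j. paley_13 (p ! i) (p ! j))"

text \<open>In the Paley graph the neighbours of a vertex form a 6-cycle. The path 1, 2, 3 and the
  order of 4, 5, 6 fix a starting point and a direction on it, and the sorted columns then order the
  six non-neighbours. Multiplication by squares rotates this cycle, but no automorphism fixing
  vertex 0 reflects it; hence each direction contributes its own matrix.\<close>

lemma adj_matrix_paley_order:
  assumes nc: "all_triples row_triple (rows 0 (adj_matrix 13 e))"
    and v: "list_all (e 0) [1..<7]" "list_all (\<lambda>i. \<not> e 0 i) [7..<13]"
    and path: "e 1 2" "e 2 3"
    and A: "lex_ge [e 3 4, e 1 4] [e 3 5, e 1 5]" "lex_ge [e 3 5, e 1 5] [e 3 6, e 1 6]"
    and B: "list_all (\<lambda>b. lex_ge (map (\<lambda>a. e a b) [1..<7]) (map (\<lambda>a. e a (Suc b)) [1..<7])) [7..<12]"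
  shows "adj_matrix 13 e = paley_matrix paley_order1 \<or> adj_matrix 13 e = paley_matrix paley_order2"
proof (rule ccontr)
  note [[argo_timeout = 600]]
  assume no: "\<not> ?thesis"
  have upt_7_12: "[7..<12] = [7, 8, 9, 10, 11]"
    by (simp add: upt_rec)
  note V = v[unfolded upts, simplified] path[unfolded One_nat_def]
  note M = adj_matrix_def[of 13 e, unfolded upts list.map, simplified, simplified V]
  note F = nc[unfolded M expand_simps]
  note O = A[simplified V lex_ge.simps simp_thms One_nat_def]
  note O2 = B[unfolded upts upt_7_12 list.map, simplified, simplified V]
  note Q = no[unfolded M, unfolded adj_matrix_def upts list.map,
      simplified paley_13_def paley_order1_def paley_order2_def, simplified]
  show False
    using F O O2 Q by (elim conjE) argo
qed

section \<open>Sorted vertex orders and the column patterns\<close>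

lemma ex_decreasing_enumeration:
  fixes k :: "'a \<Rightarrow> nat"
  assumes "finite S"
  obtains xs where "distinct xs" "set xs = S" "length xs = card S" "sorted_wrt (\<lambda>x y. k y \<le> k x) xs"
proof -
  obtain ys where ys: "distinct ys" "set ys = S"
    using assms finite_distinct_list by blast
  have "sorted (map k (sort_key k ys))"
    by simp
  then have "sorted_wrt (\<lambda>x y. k y \<le> k x) (rev (sort_key k ys))"
    by (simp add: sorted_wrt_rev sorted_map)
  then show thesis
    using that[of "rev (sort_key k ys)"] ys distinct_card[of ys] by simp
qed

lemma code_less: "code xs < 2 ^ length xs"
  by (induction xs) (auto simp: of_bool_def)

text \<open>By \<open>code_less\<close> the tail is worth less than the leading bit, so the first
  difference decides the comparison.\<close>

lemma lex_ge_if_code_ge: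
  "length xs = length ys \<Longrightarrow> code ys \<le> code xs \<Longrightarrow> lex_ge xs ys"
proof (induction xs ys rule: list_induct2)
  case (Cons x xs y ys)
  then show ?case
    using code_less[of xs] code_less[of ys] by (cases x; cases y) auto
qed simp

text \<open>For a concrete list this unfolds to a propositional formula, which makes cardinalities
  accessible to the solver. Counts are written with \<open>Suc\<close> so that the equations
  apply.\<close>

fun exactly :: "nat \<Rightarrow> bool list \<Rightarrow> bool" where
  "exactly n [] = (n = 0)"
| "exactly 0 (x # xs) = (\<not> x \<and> exactly 0 xs)"
| "exactly (Suc n) (x # xs) = (x \<and> exactly n xs \<or> \<not> x \<and> exactly (Suc n) xs)"

text \<open>The rows are the traces on \<open>M v\<close> of three neighbours of \<open>v\<close>,
  and the last three assumptions are their common non-neighbours. The columns are sorted but the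
  rows are not, so patterns that differ by a permutation of the rows are listed separately.\<close>

lemma column_pattern:
  fixes x1 x2 x3 x4 x5 x6 x7 y1 y2 y3 y4 y5 y6 y7 z1 z2 z3 z4 z5 z6 z7 :: bool
  assumes sorted: "code [x2, y2, z2] \<le> code [x1, y1, z1]" "code [x3, y3, z3] \<le> code [x2, y2, z2]"
      "code [x4, y4, z4] \<le> code [x3, y3, z3]" "code [x5, y5, z5] \<le> code [x4, y4, z4]"
      "code [x6, y6, z6] \<le> code [x5, y5, z5]" "code [x7, y7, z7] \<le> code [x6, y6, z6]"
    and x: "exactly (Suc (Suc (Suc (Suc 0)))) [x1, x2, x3, x4, x5, x6, x7]"
    and y: "exactly (Suc (Suc (Suc (Suc 0)))) [y1, y2, y3, y4, y5, y6, y7]"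
    and z: "exactly (Suc (Suc (Suc (Suc 0)))) [z1, z2, z3, z4, z5, z6, z7]"
    and xy: "\<not> x1 \<and> \<not> y1 \<or> \<not> x2 \<and> \<not> y2 \<or> \<not> x3 \<and> \<not> y3 \<or> \<not> x4 \<and> \<not> y4 \<or> \<not> x5 \<and> \<not> y5 \<or>
      \<not> x6 \<and> \<not> y6 \<or> \<not> x7 \<and> \<not> y7"
    and xz: "\<not> x1 \<and> \<not> z1 \<or> \<not> x2 \<and> \<not> z2 \<or> \<not> x3 \<and> \<not> z3 \<or> \<not> x4 \<and> \<not> z4 \<or> \<not> x5 \<and> \<not> z5 \<or>
      \<not> x6 \<and> \<not> z6 \<or> \<not> x7 \<and> \<not> z7"
    and yz: "\<not> y1 \<and> \<not> z1 \<or> \<not> y2 \<and> \<not> z2 \<or> \<not> y3 \<and> \<not> z3 \<or> \<not> y4 \<and> \<not> z4 \<or> \<not> y5 \<and> \<not> z5 \<or>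
      \<not> y6 \<and> \<not> z6 \<or> \<not> y7 \<and> \<not> z7"
  shows "[code [x1, y1, z1], code [x2, y2, z2], code [x3, y3, z3], code [x4, y4, z4],
    code [x5, y5, z5], code [x6, y6, z6], code [x7, y7, z7]] \<in> set column_patterns"
proof (rule ccontr)
  note [[argo_timeout = 300]]
  note lex = sorted[THEN lex_ge_if_code_ge[rotated], unfolded lex_ge.simps]
  assume "\<not> ?thesis"
  note no = this[unfolded column_patterns_def list.set insert_iff empty_iff list.inject code_3
      simp_thms de_Morgan_disj de_Morgan_conj]
  show False
    using lex[simplified] x[simplified] y[simplified] z[simplified] xy xz yz no by (elim conjE) argo
qed

lemma length_eq_6: "length xs = 6 \<Longrightarrow> \<exists>a b c d e f. xs = [a, b, c, d, e, f]"
  by (auto simp: eval_nat_numeral length_Suc_conv)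

lemma length_eq_7: "length xs = 7 \<Longrightarrow> \<exists>a b c d e f g. xs = [a, b, c, d, e, f, g]"
  by (auto simp: eval_nat_numeral length_Suc_conv)

lemma length_eq_3: "length xs = 3 \<Longrightarrow> \<exists>a b c. xs = [a, b, c]"
  by (auto simp: eval_nat_numeral length_Suc_conv)

lemma exactly_iff_card: "distinct xs \<Longrightarrow> exactly n (map P xs) \<longleftrightarrow> card {x \<in> set xs. P x} = n"
proof (induction xs arbitrary: n)
  case (Cons x xs)
  have "{y \<in> set (x # xs). P y} = (if P x then insert x {y \<in> set xs. P y} else {y \<in> set xs. P y})"
    by auto
  then show ?case
    using Cons by (cases n) auto
qed auto

section \<open>Existence of twins\<close>

context nc_graph
begin

text \<open>Double counting of the edges between \<open>N v\<close> and \<open>M v\<close>: the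
  seven vertices of \<open>M v\<close> contribute at least three each, hence 21, while the six
  vertices of \<open>N v\<close> have at most four each. So at least 21 - 18 of them attain
  four.\<close>

lemma three_large_rows:
  assumes v: "v \<in> V" and 6: "card (N v) = 6" and 7: "card (M v) = 7"
  obtains a1 a2 a3 where "{a1, a2, a3} \<subseteq> N v" "a1 \<noteq> a2" "a1 \<noteq> a3" "a2 \<noteq> a3"
    "card (N a1 \<inter> M v) = 4" "card (N a2 \<inter> M v) = 4" "card (N a3 \<inter> M v) = 4"
proof -
  define K where "K = {a \<in> N v. card (N a \<inter> M v) = 4}"
  have "(\<Sum>b\<in>M v. 3) \<le> (\<Sum>b\<in>M v. card (N b \<inter> N v))"
    using card_N_Int_N[OF v] 6 7 by (intro sum_mono) auto
  also have "\<dots> = (\<Sum>a\<in>N v. card (N a \<inter> M v))"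
  proof (rule sum_multicount_gen[symmetric, where R = e, THEN trans, rotated -1])
    show "(\<Sum>i\<in>N v. card {j \<in> M v. e i j}) = (\<Sum>a\<in>N v. card (N a \<inter> M v))"
      by (intro sum.cong refl arg_cong[where f = card]) (auto simp: N_def M_def)
  next
    show "\<forall>j\<in>M v. card {i \<in> N v. e i j} = card (N j \<inter> N v)"
      by (intro ballI arg_cong[where f = card]) (use sym in \<open>auto simp: N_def M_def\<close>)
  qed auto
  also have "\<dots> \<le> (\<Sum>a\<in>N v. 3 + of_bool (a \<in> K))"
  proof (rule sum_mono)
    fix a assume "a \<in> N v"
    then show "card (N a \<inter> M v) \<le> 3 + of_bool (a \<in> K)"
      using card_N_Int_N_le[OF v, of a] 6 7 by (auto simp: K_def)
  qed
  also have "\<dots> = 18 + card K"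
    using 6 by (simp add: sum.distrib K_def Int_def)
  finally have "3 \<le> card K"
    using 7 by simp
  then obtain T where "T \<subseteq> K" "card T = 3"
    by (metis obtain_subset_with_card_n)
  then show thesis
    using that by (auto simp: card_3_iff K_def)
qed

lemma ex_twins_if_degree_6:
  assumes V: "card V = 14" and v: "v \<in> V" and 6: "card (N v) = 6"
  shows "\<exists>x y. twins V e x y"
proof (rule ccontr)
  assume no: "\<not> ?thesis"
  have 7: "card (M v) = 7"
    using card_N_M[OF v] V 6 by simp
  obtain a1 a2 a3 where a: "{a1, a2, a3} \<subseteq> N v" "a1 \<noteq> a2" "a1 \<noteq> a3" "a2 \<noteq> a3"
    and large: "card (N a1 \<inter> M v) = 4" "card (N a2 \<inter> M v) = 4" "card (N a3 \<inter> M v) = 4"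
    using three_large_rows[OF v 6 7] .
  have "card (N v - {a1, a2, a3}) = 3"
    using a 6 by (simp add: card_Diff_subset)
  then obtain as where as: "distinct as" "set as = N v - {a1, a2, a3}" "length as = 3"
    by (metis distinct_card finite_Diff finite_N finite_distinct_list)
  then obtain a4 a5 a6 where as_eq: "as = [a4, a5, a6]"
    using length_eq_3 by blast
  obtain bs where bs: "distinct bs" "set bs = M v" "length bs = card (M v)"
    "sorted_wrt (\<lambda>x y. code [e a1 y, e a2 y, e a3 y] \<le> code [e a1 x, e a2 x, e a3 x]) bs"
    using ex_decreasing_enumeration[where S = "M v" and k = "\<lambda>b. code [e a1 b, e a2 b, e a3 b]", OF finite_M]
    by blast
  obtain b1 b2 b3 b4 b5 b6 b7 where bs_eq: "bs = [b1, b2, b3, b4, b5, b6, b7]"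
    using length_eq_7[of bs] bs(3) 7 by auto
  \<comment> \<open>Position 0 is \<open>v\<close>, positions 1 to 6 are its neighbours with the
    three large rows first, and positions 7 to 13 are the sorted non-neighbours, as
    \<open>no_column_pattern\<close> expects.\<close>
  define L where "L = v # a1 # a2 # a3 # as @ bs"
  have NM: "N v = {a1, a2, a3, a4, a5, a6}" "M v = {b1, b2, b3, b4, b5, b6, b7}"
    using a as bs unfolding as_eq bs_eq by auto
  have disj: "v \<notin> N v" "v \<notin> M v" "N v \<inter> M v = {}" "V = insert v (N v \<union> M v)"
    using v irrefl by (auto simp: N_def M_def co_def)
  interpret L: listed_nc_graph V e L
  proof unfold_locales
    show "distinct L"
      using a as(1,2) bs(1,2) disj by (auto simp: L_def)
    show "set L = V"
      using a as(2) bs(2) disj(4) by (auto simp: L_def)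
  qed
  have len: "length L = 14"
    by (simp add: L_def as_eq bs_eq)
  have triples: "all_triples row_triple (rows 0 (adj_matrix 14 L.E))"
    using L.all_triples_rows len by simp
  have distinct: "all_pairs row_distinct (rows 0 (adj_matrix 14 L.E))"
    using no L.row_distinct_if_not_twins len by (intro all_pairsI) (simp add: L.length_adj_matrix)
  have vN: "list_all (L.E 0) [1..<7]" "list_all (\<lambda>i. \<not> L.E 0 i) [7..<14]"
  proof -
    have "\<forall>x\<in>{a1, a2, a3, a4, a5, a6}. e v x" "\<forall>x\<in>{b1, b2, b3, b4, b5, b6, b7}. \<not> e v x"
      unfolding NM[symmetric] by (auto simp: N_def M_def co_def)
    then show "list_all (L.E 0) [1..<7]" "list_all (\<lambda>i. \<not> L.E 0 i) [7..<14]"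
      unfolding upts L_def as_eq bs_eq by simp_all
  qed
  have row: "exactly (Suc (Suc (Suc (Suc 0)))) (map (e x) bs)" if "card (N x \<inter> M v) = 4" for x
  proof -
    have "N x \<inter> M v = {b \<in> set bs. e x b}"
      using bs(2) by (auto simp: N_def M_def)
    then show ?thesis
      using exactly_iff_card[OF bs(1), of _ "e x"] that by simp
  qed
  have miss: "\<exists>b\<in>set bs. \<not> e x b \<and> \<not> e y b" if "x \<in> N v" "y \<in> N v" "x \<noteq> y" for x y
    using common_nonneighbour[OF v that] bs(2) by metis
  have "map (\<lambda>b. code [L.E 1 b, L.E 2 b, L.E 3 b]) [7..<14] =
      [code [e a1 b1, e a2 b1, e a3 b1], code [e a1 b2, e a2 b2, e a3 b2],
       code [e a1 b3, e a2 b3, e a3 b3], code [e a1 b4, e a2 b4, e a3 b4],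
       code [e a1 b5, e a2 b5, e a3 b5], code [e a1 b6, e a2 b6, e a3 b6],
       code [e a1 b7, e a2 b7, e a3 b7]]"
    unfolding upts L_def as_eq bs_eq by (simp del: code.simps)
  also have "\<dots> \<in> set column_patterns"
    using bs(4) row[OF large(1)] row[OF large(2)] row[OF large(3)]
      miss[of a1 a2] miss[of a1 a3] miss[of a2 a3] a
    unfolding bs_eq
    by (intro column_pattern) (simp_all del: code.simps)
  finally show False
    using no_column_pattern[OF triples distinct vN] by contradiction
qed

lemma twins_co: "twins V (co e) x y \<longleftrightarrow> twins V e x y"
  by (auto simp: twins_def co_def)

lemma ex_twins:
  assumes "card V = 14"
  shows "\<exists>x y. twins V e x y"
proof -
  obtain v where v: "v \<in> V"
    using assms by fastforce
  have "card (N v) + card (M v) = 13"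
    using card_N_M[OF v] assms by simp
  \<comment> \<open>Both summands are at least 6 and their sum is 13.\<close>
  then consider "card (N v) = 6" | "card (M v) = 6"
    using card_N_ge_6[OF v] card_M_ge_6[OF v] assms by fastforce
  then show ?thesis
  proof cases
    case 1
    then show ?thesis
      using ex_twins_if_degree_6[OF assms v] by blast
  next
    case 2
    interpret c: nc_graph V "co e"
      by (rule nc_graph_co)
    show ?thesis
      using c.ex_twins_if_degree_6[OF assms v] 2 by (simp add: N_co twins_co)
  qed
qed

end

section \<open>The Paley graph\<close>

lemma residues_13: "{0..<13} = set [0, 1, 2, 3, 4, 5, 6, 7, 8, 9, 10, 11, 12 :: int]"
  by (rule Set.set_eqI) (simp, presburger)

lemma paley_13_commute: "paley_13 x y = paley_13 y x"
proof -
  have "(y - x) mod 13 = (- (x - y)) mod 13"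
    by simp
  also have "\<dots> = (if (x - y) mod 13 = 0 then 0 else 13 - (x - y) mod 13)"
    by (simp only: zmod_zminus1_eq_if)
  finally show ?thesis
    by (auto simp: paley_13_def split: if_splits)
qed

lemma not_paley_13_refl: "\<not> paley_13 x x"
  by (simp add: paley_13_def)

lemma adj_matrix_eqD:
  assumes "adj_matrix n e = adj_matrix n f" "i < j" "j < n"
  shows "e i j = f i j"
proof -
  have "adj_matrix n e ! i ! j = adj_matrix n f ! i ! j"
    using assms(1) by simp
  then show ?thesis
    using assms(2,3) by (simp add: adj_matrix_def)
qed

context nc_graph
begin

lemma card_13:
  assumes "card V = 13" "v \<in> V"
  shows "card (N v) = 6" "card (M v) = 6"
  using card_N_M[OF assms(2)] card_N_ge_6[OF assms(2)] card_M_ge_6[OF assms(2)] assms(1) by simp_all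

text \<open>The six neighbours of \<open>a\<close> are \<open>v\<close>, at most three vertices of
  \<open>M v\<close>, and the common neighbours.\<close>

lemma two_common_neighbours:
  assumes V: "card V = 13" and v: "v \<in> V" and a: "a \<in> N v"
  shows "2 \<le> card (N a \<inter> N v)"
proof -
  have aV: "a \<in> V" and "e a v" "\<not> e v v"
    using a sym irrefl by (auto simp: N_def)
  then have "N a = insert v ((N a \<inter> N v) \<union> (N a \<inter> M v))" "v \<notin> (N a \<inter> N v) \<union> (N a \<inter> M v)"
      "(N a \<inter> N v) \<inter> (N a \<inter> M v) = {}"
    using v by (auto simp: N_def M_def co_def)
  then have "card (N a) = Suc (card (N a \<inter> N v) + card (N a \<inter> M v))"
    by (metis card_Un_disjoint card_insert_disjoint finite_Int finite_N finite_Un)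
  moreover have "card (N a \<inter> M v) + 3 \<le> 6"
    using card_N_Int_N_le[OF v a] card_13[OF V v] by simp
  ultimately show ?thesis
    using card_13[OF V aV] by simp
qed

lemma paley_labelling:
  assumes V: "card V = 13"
  obtains h where "bij_betw h V {0..<13}" "\<And>x y. x \<in> V \<Longrightarrow> y \<in> V \<Longrightarrow> e x y = paley_13 (h x) (h y)"
proof -
  obtain v where v: "v \<in> V"
    using V by fastforce
  note NM6 = card_13[OF V v]
  obtain a1 where a1: "a1 \<in> N v"
    using NM6(1) by fastforce
  \<comment> \<open>Inside \<open>N v\<close> all degrees are at least 2, so a path
    \<open>a1\<close>, \<open>a2\<close>, \<open>a3\<close> as required by the normal form can be
    chosen there.\<close>
  have "N a1 \<inter> N v \<noteq> {}"
    using two_common_neighbours[OF V v a1] by auto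
  then obtain a2 where a2: "a2 \<in> N v" "e a1 a2"
    by (auto simp: N_def)
  have "\<not> N a2 \<inter> N v \<subseteq> {a1}"
    using two_common_neighbours[OF V v a2(1)] card_mono[of "{a1}" "N a2 \<inter> N v"] by auto
  then obtain a3 where a3: "a3 \<in> N v" "e a2 a3" "a3 \<noteq> a1"
    by (auto simp: N_def)
  have ne: "a1 \<noteq> a2" "a2 \<noteq> a3"
    using a2 a3 irrefl by auto
  have "card (N v - {a1, a2, a3}) = 3"
    using a1 a2 a3 ne NM6 by (simp add: card_Diff_subset)
  moreover obtain as where as: "distinct as" "set as = N v - {a1, a2, a3}"
      "length as = card (N v - {a1, a2, a3})"
      "sorted_wrt (\<lambda>x y. code [e a3 y, e a1 y] \<le> code [e a3 x, e a1 x]) as"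
    using ex_decreasing_enumeration[where S = "N v - {a1, a2, a3}" and k = "\<lambda>a. code [e a3 a, e a1 a]",
        OF finite_Diff[OF finite_N]]
    by blast
  ultimately obtain a4 a5 a6 where as_eq: "as = [a4, a5, a6]"
    using length_eq_3[of as] by auto
  define k where "k b = code (map (\<lambda>a. e a b) [a1, a2, a3, a4, a5, a6])" for b
  obtain bs where bs: "distinct bs" "set bs = M v" "length bs = card (M v)"
      "sorted_wrt (\<lambda>x y. k y \<le> k x) bs"
    using ex_decreasing_enumeration[where S = "M v" and k = k, OF finite_M] by blast
  obtain b1 b2 b3 b4 b5 b6 where bs_eq: "bs = [b1, b2, b3, b4, b5, b6]"
    using length_eq_6[of bs] bs(3) NM6 by auto
  define L where "L = v # a1 # a2 # a3 # as @ bs"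
  have NM: "N v = {a1, a2, a3, a4, a5, a6}" "M v = {b1, b2, b3, b4, b5, b6}"
    using a1 a2 a3 as bs unfolding as_eq bs_eq by auto
  have disj: "v \<notin> N v" "v \<notin> M v" "N v \<inter> M v = {}" "V = insert v (N v \<union> M v)"
    using v irrefl by (auto simp: N_def M_def co_def)
  interpret L: listed_nc_graph V e L
  proof unfold_locales
    show "distinct L"
      using a1 a2 a3 ne as(1,2) bs(1,2) disj by (auto simp: L_def)
    show "set L = V"
      using a1 a2 a3 as(2) bs(2) disj(4) by (auto simp: L_def)
  qed
  have len: "length L = 13"
    by (simp add: L_def as_eq bs_eq)
  have triples: "all_triples row_triple (rows 0 (adj_matrix 13 L.E))"
    using L.all_triples_rows len by simp
  have vN: "list_all (L.E 0) [1..<7]" "list_all (\<lambda>i. \<not> L.E 0 i) [7..<13]"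
  proof -
    have "\<forall>x\<in>{a1, a2, a3, a4, a5, a6}. e v x" "\<forall>x\<in>{b1, b2, b3, b4, b5, b6}. \<not> e v x"
      unfolding NM[symmetric] by (auto simp: N_def M_def co_def)
    then show "list_all (L.E 0) [1..<7]" "list_all (\<lambda>i. \<not> L.E 0 i) [7..<13]"
      unfolding upts L_def as_eq bs_eq by simp_all
  qed
  have path: "L.E 1 2" "L.E 2 3"
    using a2 a3 by (simp_all add: L_def)
  have "lex_ge [e a3 a4, e a1 a4] [e a3 a5, e a1 a5]" "lex_ge [e a3 a5, e a1 a5] [e a3 a6, e a1 a6]"
    using as(4) unfolding as_eq by (auto intro: lex_ge_if_code_ge simp del: code.simps lex_ge.simps)
  then have A: "lex_ge [L.E 3 4, L.E 1 4] [L.E 3 5, L.E 1 5]" "lex_ge [L.E 3 5, L.E 1 5] [L.E 3 6, L.E 1 6]"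
    unfolding L_def as_eq bs_eq by (simp_all del: lex_ge.simps)
  have kb: "lex_ge (map (\<lambda>a. e a x) [a1, a2, a3, a4, a5, a6]) (map (\<lambda>a. e a y) [a1, a2, a3, a4, a5, a6])"
    if "k y \<le> k x" for x y
    using that unfolding k_def by (intro lex_ge_if_code_ge) simp_all
  have "k b2 \<le> k b1" "k b3 \<le> k b2" "k b4 \<le> k b3" "k b5 \<le> k b4" "k b6 \<le> k b5"
    using bs(4) unfolding bs_eq by simp_all
  note kb' = this[THEN kb]
  have upt_7_12: "[7..<12] = [7, 8, 9, 10, 11]"
    by (simp add: upt_rec)
  have B: "list_all (\<lambda>b. lex_ge (map (\<lambda>a. L.E a b) [1..<7]) (map (\<lambda>a. L.E a (Suc b)) [1..<7])) [7..<12]"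
    using kb' unfolding upts upt_7_12 L_def as_eq bs_eq by (simp del: lex_ge.simps)
  obtain p :: "int list" where p: "p = paley_order1 \<or> p = paley_order2"
      "adj_matrix 13 L.E = paley_matrix p"
    using adj_matrix_paley_order[OF triples vN path A B] by blast
  have p': "distinct p" "length p = 13" "set p = {0..<13}"
    using p(1) by (auto simp: paley_order1_def paley_order2_def residues_13)
  have paley: "L.E i j = paley_13 (p ! i) (p ! j)" if ij: "i < 13" "j < 13" for i j
  proof (cases i j rule: linorder_cases)
    case less
    then show ?thesis
      using adj_matrix_eqD[OF p(2)] ij by blast
  next
    case equal
    then show ?thesis
      using irrefl not_paley_13_refl by simp
  next
    case greater
    then show ?thesis
      using adj_matrix_eqD[OF p(2), of j i] ij L.e_commute paley_13_commute by metis
  qed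
  define h where "h x = the (map_of (zip L p) x)" for x
  have h: "h (L ! i) = p ! i" if "i < 13" for i
    using map_of_zip_nth[of L p i] that len p'(2) L.distinct_L by (simp add: h_def)
  have "bij_betw h V {0..<13}"
    unfolding bij_betw_def
  proof
    show "inj_on h V"
    proof (rule inj_onI)
      fix x y assume "x \<in> V" "y \<in> V" "h x = h y"
      then show "x = y"
        using L.in_V_nth[of x] L.in_V_nth[of y] len h p'(1,2) by (metis nth_eq_iff_index_eq)
    qed
    have "map h L = p"
      using h len p'(2) by (intro nth_equalityI) simp_all
    then show "h ` V = {0..<13}"
      using L.set_L p'(3) by (metis set_map)
  qed
  moreover have "e x y = paley_13 (h x) (h y)" if "x \<in> V" "y \<in> V" for x y
    using L.in_V_nth[OF that(1)] L.in_V_nth[OF that(2)] paley h len by metis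
  ultimately show thesis
    using that by blast
qed

end

text \<open>Only a star whose witness is \<open>y\<close> is affected. Such a star does not contain
  \<open>x\<close>: an edge from \<open>x\<close> to another vertex of the star would give one from
  \<open>y\<close>. Hence \<open>x\<close> can replace \<open>y\<close> as a witness.\<close>

lemma undominated_remove_twin:
  assumes und: "undominated V e" and tw: "twins V e x y"
    and sym: "\<And>a b. e a b = e b a"
  shows "undominated (V - {y}) e"
  unfolding undominated_def
proof (intro ballI impI)
  fix c s t assume V: "c \<in> V - {y}" "s \<in> V - {y}" "t \<in> V - {y}" and cst: "s \<noteq> t \<and> e c s \<and> e c t"
  then obtain u where u: "u \<in> V" "co e c u" "co e s u" "co e t u"
    using undominatedE[OF und, of c s t] by blast
  have tw': "e r x = e r y" if "r \<in> V" "r \<noteq> x" "r \<noteq> y" for r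
    using tw that sym unfolding twins_def by (metis Diff_iff insert_iff singletonD)
  show "\<exists>u\<in>V - {y}. co e c u \<and> co e s u \<and> co e t u"
  proof (cases "u = y")
    case False
    then show ?thesis
      using u by blast
  next
    case True
    have ny: "\<not> e c y" "\<not> e s y" "\<not> e t y"
      using u True by (auto simp: co_def)
    have "c \<noteq> x"
      using tw cst ny V sym by (metis DiffE insertI1 twins_def tw')
    moreover have "s \<noteq> x" "t \<noteq> x"
      using tw'[of c] calculation ny cst V by auto
    ultimately have "co e c x" "co e s x" "co e t x"
      using tw'[of c] tw'[of s] tw'[of t] ny V by (auto simp: co_def)
    moreover have "x \<in> V - {y}"
      using tw by (auto simp: twins_def)
    ultimately show ?thesis
      by blast
  qed
qed

lemma (in nc_graph) nc_graph_remove_twin: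
  assumes tw: "twins V e x y"
  shows "nc_graph (V - {y}) e"
proof unfold_locales
  show "undominated (V - {y}) e"
    using undominated_remove_twin[OF undominated tw] sym by blast
  have "co e a b = co e b a" for a b
    using sym by (auto simp: co_def)
  then show "undominated (V - {y}) (co e)"
    using undominated_remove_twin[OF undominated_co] tw by (simp add: twins_co)
qed (use finite_V sym irrefl in auto)

section \<open>The Paley graph satisfies the condition\<close>

lemma QuadRes_13_iff: "QuadRes 13 a \<longleftrightarrow> a mod 13 \<in> {0, 1, 3, 4, 9, 10, 12}"
proof
  assume "QuadRes 13 a"
  then obtain y where y: "y\<^sup>2 mod 13 = a mod 13"
    by (auto simp: QuadRes_def cong_def)
  define r where "r = y mod 13"
  have "r \<in> {0..<13}"
    by (simp add: r_def)
  then have "r \<in> {0, 1, 2, 3, 4, 5, 6, 7, 8, 9, 10, 11, 12}"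
    unfolding residues_13 by simp
  moreover have "a mod 13 = r\<^sup>2 mod 13"
    using y[symmetric] by (simp add: r_def power_mod)
  ultimately show "a mod 13 \<in> {0, 1, 3, 4, 9, 10, 12}"
    by auto
next
  assume a: "a mod 13 \<in> {0, 1, 3, 4, 9, 10, 12}"
  have *: "QuadRes 13 a" if "a mod 13 = y\<^sup>2 mod 13" for y
    using that[symmetric] by (auto simp: QuadRes_def cong_def)
  \<comment> \<open>Since y and -y have the same square, the squares of 0 to 6 exhaust the listed
    residues.\<close>
  show "QuadRes 13 a"
    using a *[of 0] *[of 1] *[of 2] *[of 3] *[of 4] *[of 5] *[of 6] by auto
qed

lemma adj_QR13: "adj QR13 x y \<longleftrightarrow> x \<in> {0..<13} \<and> y \<in> {0..<13} \<and> paley_13 x y"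
proof -
  have "(x - y) mod 13 \<noteq> 0" if "x \<in> {0..<13}" "y \<in> {0..<13}" "x \<noteq> y"
  proof
    assume "(x - y) mod 13 = 0"
    then have "x mod 13 = y mod 13"
      by (simp add: mod_eq_dvd_iff mod_eq_0_iff_dvd)
    then show False
      using that by simp
  qed
  then show ?thesis
    using not_paley_13_refl[of x] by (auto simp: adj_def QR13_def QuadRes_13_iff paley_13_def)
qed

lemma paley_13_mod: "paley_13 (a mod 13) (b mod 13) = paley_13 a b"
  by (simp add: paley_13_def mod_diff_eq)

lemma paley_13_shift: "paley_13 ((a + c) mod 13) ((b + c) mod 13) = paley_13 a b"
  unfolding paley_13_mod by (simp add: paley_13_def)

lemma mod_13_shift:
  fixes x c :: int
  assumes "x \<in> {0..<13}"
  shows "((x + c) mod 13 - c) mod 13 = x" "((x - c) mod 13 + c) mod 13 = x"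
  using assms by (simp_all add: mod_simps)

text \<open>The range restriction comes from the inequality inside \<open>co\<close>: reduction
  modulo 13 is injective only on representatives.\<close>

lemma co_paley_13_shift:
  assumes "a \<in> {0..<13}" "b \<in> {0..<13}"
  shows "co paley_13 ((a + c) mod 13) ((b + c) mod 13) = co paley_13 a b"
  using mod_13_shift(1)[OF assms(1), of c] mod_13_shift(1)[OF assms(2), of c] paley_13_shift
  unfolding co_def by metis

text \<open>A translation moves the centre of a star to 0, so that only the two leaves remain to be
  enumerated by evaluation.\<close>

lemma undominated_if_translation_invariant:
  fixes f :: "int \<Rightarrow> int \<Rightarrow> bool"
  assumes shift: "\<And>a b c. a \<in> {0..<13} \<Longrightarrow> b \<in> {0..<13} \<Longrightarrow> f ((a + c) mod 13) ((b + c) mod 13) = f a b"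
    and zero: "\<And>s t. s \<in> {0..<13} \<Longrightarrow> t \<in> {0..<13} \<Longrightarrow> s \<noteq> t \<Longrightarrow> f 0 s \<Longrightarrow> f 0 t \<Longrightarrow>
      \<exists>u\<in>{0..<13}. co f 0 u \<and> co f s u \<and> co f t u"
  shows "undominated {0..<13} f"
  unfolding undominated_def
proof (intro ballI impI)
  fix x y z :: int
  assume V: "x \<in> {0..<13}" "y \<in> {0..<13}" "z \<in> {0..<13}" and xyz: "y \<noteq> z \<and> f x y \<and> f x z"
  define s where "s = (y - x) mod 13"
  define t where "t = (z - x) mod 13"
  have st: "s \<in> {0..<13}" "t \<in> {0..<13}"
    by (simp_all add: s_def t_def)
  have shifted: "(0 + x) mod 13 = x" "(s + x) mod 13 = y" "(t + x) mod 13 = z"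
    using V mod_13_shift(2) by (simp_all add: s_def t_def)
  have "f 0 s" "f 0 t" "s \<noteq> t"
    using shift[of 0 s x] shift[of 0 t x] shifted st xyz by auto
  then obtain u where u: "u \<in> {0..<13}" "co f 0 u" "co f s u" "co f t u"
    using zero[OF st] by blast
  have co_shift: "co f ((a + x) mod 13) ((b + x) mod 13)" if "a \<in> {0..<13}" "b \<in> {0..<13}" "co f a b" for a b
    using that shift[of a b x] mod_13_shift(1)[of a x] mod_13_shift(1)[of b x] unfolding co_def by metis
  have "co f x ((u + x) mod 13) \<and> co f y ((u + x) mod 13) \<and> co f z ((u + x) mod 13)"
    using co_shift[OF _ u(1) u(2)] co_shift[OF _ u(1) u(3)] co_shift[OF _ u(1) u(4)] st shifted by simp
  then show "\<exists>u\<in>{0..<13}. co f x u \<and> co f y u \<and> co f z u"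
    by (intro bexI[of _ "(u + x) mod 13"]) simp_all
qed

lemma nc_graph_paley_13: "nc_graph {0..<13} paley_13"
proof unfold_locales
  show "undominated {0..<13} paley_13"
  proof (rule undominated_if_translation_invariant)
    fix s t :: int
    assume "s \<in> {0..<13}" "t \<in> {0..<13}" "s \<noteq> t" "paley_13 0 s" "paley_13 0 t"
    moreover have "\<forall>s\<in>{0..<13}. \<forall>t\<in>{0..<13}. s \<noteq> t \<and> paley_13 0 s \<and> paley_13 0 t \<longrightarrow>
      (\<exists>u\<in>{0..<13}. co paley_13 0 u \<and> co paley_13 s u \<and> co paley_13 t u)"
      unfolding residues_13 by code_simp
    ultimately show "\<exists>u\<in>{0..<13}. co paley_13 0 u \<and> co paley_13 s u \<and> co paley_13 t u"
      by blast
  qed (rule paley_13_shift)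
  show "undominated {0..<13} (co paley_13)"
  proof (rule undominated_if_translation_invariant)
    fix s t :: int
    assume "s \<in> {0..<13}" "t \<in> {0..<13}" "s \<noteq> t" "co paley_13 0 s" "co paley_13 0 t"
    moreover have "\<forall>s\<in>{0..<13}. \<forall>t\<in>{0..<13}. s \<noteq> t \<and> co paley_13 0 s \<and> co paley_13 0 t \<longrightarrow>
      (\<exists>u\<in>{0..<13}. co (co paley_13) 0 u \<and> co (co paley_13) s u \<and> co (co paley_13) t u)"
      unfolding residues_13 by code_simp
    ultimately show "\<exists>u\<in>{0..<13}. co (co paley_13) 0 u \<and> co (co paley_13) s u \<and> co (co paley_13) t u"
      by blast
  qed (rule co_paley_13_shift)
qed (use paley_13_commute not_paley_13_refl in auto)

interpretation paley: nc_graph "{0..<13}" paley_13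
  by (rule nc_graph_paley_13)

section \<open>Adding twins\<close>

lemma undominated_image:
  assumes "undominated V e" "\<And>a b. e' (f a) (f b) = e a b" "inj f"
  shows "undominated (f ` V) e'"
  using assms unfolding undominated_def co_def by (simp add: inj_eq)

text \<open>A star that contains at most one of the twins is folded onto \<open>V - {y}\<close> by
  replacing \<open>y\<close> with \<open>x\<close>, and the witness found there still works. A star
  that contains both has a third vertex adjacent to both, so a common non-neighbour of
  \<open>x\<close> and this vertex is enough; \<open>edge\<close> supplies it.\<close>

lemma undominated_add_twin:
  assumes und: "undominated (V - {y}) e" and tw: "twins V e x y"
    and sym: "\<And>a b. e a b = e b a" and irr: "\<And>a. \<not> e a a"
    and edge: "\<And>z. z \<in> V - {x, y} \<Longrightarrow> e x z \<Longrightarrow> \<exists>u\<in>V - {y}. co e x u \<and> co e z u"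
  shows "undominated V e"
proof -
  have V: "x \<in> V - {y}" "y \<in> V" and tw': "\<And>u. u \<in> V \<Longrightarrow> u \<noteq> x \<Longrightarrow> u \<noteq> y \<Longrightarrow> e x u = e y u"
    using tw by (auto simp: twins_def)
  define r where "r a = (if a = y then x else a)" for a
  have co_r: "co e a u" if "a \<in> V" "u \<in> V - {y}" "co e (r a) u" for a u
    using that tw'[of u] by (cases "a = y") (auto simp: r_def co_def)
  have e_r: "e (r a) (r b)" if "a \<in> V" "b \<in> V" "e a b" "r a \<noteq> r b" for a b
    using that tw'[of a] tw'[of b] sym unfolding r_def by (metis (full_types))
  have rV: "r a \<in> V - {y}" if "a \<in> V" for a
    using that V by (auto simp: r_def)
  have edge': "\<exists>u\<in>V. co e x u \<and> co e y u \<and> co e z u" if z: "z \<in> V" "z \<noteq> x" "z \<noteq> y" "e x z" for z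
  proof -
    obtain u where u: "u \<in> V - {y}" "co e x u" "co e z u"
      using edge z by blast
    then show ?thesis
      using co_r[of y u] V by (auto simp: r_def)
  qed
  show ?thesis
    unfolding undominated_def
  proof (intro ballI impI)
    fix c s t assume cst: "c \<in> V" "s \<in> V" "t \<in> V" and "s \<noteq> t \<and> e c s \<and> e c t"
    then have cst': "s \<noteq> t" "e c s" "e c t"
      by auto
    note cst = cst this
    have ne: "c \<noteq> s" "c \<noteq> t"
      using irr cst by auto
    show "\<exists>u\<in>V. co e c u \<and> co e s u \<and> co e t u"
    proof (cases "x \<in> {c, s, t} \<and> y \<in> {c, s, t}")
      case False
      then have r: "r c \<noteq> r s" "r c \<noteq> r t" "r s \<noteq> r t"
        using cst ne by (auto simp: r_def)
      have "e (r c) (r s)" "e (r c) (r t)"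
        using e_r r cst by blast+
      then obtain u where "u \<in> V - {y}" "co e (r c) u" "co e (r s) u" "co e (r t) u"
        using undominatedE[OF und rV[OF cst(1)] rV[OF cst(2)] rV[OF cst(3)] r(3)] by blast
      then show ?thesis
        using co_r cst by blast
    next
      case True
      have "x \<noteq> y"
        using V by auto
      with True consider "c = x" "s = y" | "c = x" "t = y" | "c = y" "s = x" | "c = y" "t = x" |
          "s = x" "t = y" | "s = y" "t = x"
        by auto
      then show ?thesis
      proof cases
        case 1
        then show ?thesis
          using edge'[of t] cst ne by auto
      next
        case 2
        then show ?thesis
          using edge'[of s] cst ne by auto
      next
        case 3
        then show ?thesis
          using edge'[of t] tw'[of t] cst ne by auto
      next
        case 4
        then show ?thesis
          using edge'[of s] tw'[of s] cst ne by auto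
      next
        case 5
        then show ?thesis
          using edge'[of c] sym[of c x] cst ne by auto
      next
        case 6
        then show ?thesis
          using edge'[of c] sym[of c x] cst ne by auto
      qed
    qed
  qed
qed

text \<open>A second neighbour of \<open>x\<close> completes the edge to a star.\<close>

lemma (in nc_graph) edge_common_nonneighbour:
  assumes x: "x \<in> V" and z: "z \<in> V" "e x z" and deg: "2 \<le> card (N x)"
  shows "\<exists>u\<in>V. co e x u \<and> co e z u"
proof -
  have "N x \<noteq> {z}"
    using deg by auto
  moreover have "z \<in> N x"
    using z by (simp add: N_def)
  ultimately obtain z' where "z' \<in> N x" "z \<noteq> z'"
    by blast
  then show ?thesis
    using undominatedE[OF undominated x z(1), of z'] z(2) unfolding N_def by blast
qed

lemma nc_graph_add_twin:
  assumes nc: "nc_graph (V - {y}) e" and V: "card (V - {y}) \<in> {13, 14}"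
    and tw: "twins V e x y"
  shows "nc_graph V e"
proof -
  interpret nc_graph "V - {y}" e
    by fact
  interpret c: nc_graph "V - {y}" "co e"
    by (rule nc_graph_co)
  have x: "x \<in> V - {y}"
    using tw by (auto simp: twins_def)
  have sym': "e a b = e b a" "co e a b = co e b a" for a b
    using sym by (auto simp: co_def)
  have deg: "2 \<le> card (N x)" "2 \<le> card (M x)"
    using card_N_ge_6[OF x V] card_M_ge_6[OF x V] by simp_all
  show ?thesis
  proof unfold_locales
    show "finite V"
      using finite_V by simp
    show "undominated V e"
      using undominated_add_twin[OF undominated tw sym'(1) irrefl] edge_common_nonneighbour[OF x _ _ deg(1)]
      by blast
    have tw': "twins V (co e) x y"
      using tw by (auto simp: twins_def co_def)
    show "undominated V (co e)"
      using undominated_add_twin[OF undominated_co tw' sym'(2) c.irrefl]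
        c.edge_common_nonneighbour[OF x] deg(2) by (simp add: N_co)
  qed (use sym irrefl in auto)
qed

lemma nc_graph_image:
  assumes nc: "nc_graph V e" and e': "\<And>a b. e' (f a) (f b) = e a b" and f: "inj f"
    and "\<And>a b. e' a b \<Longrightarrow> e' b a" "\<And>a. \<not> e' a a"
  shows "nc_graph (f ` V) e'"
proof -
  interpret nc_graph V e
    by fact
  have "co e' (f a) (f b) = co e a b" for a b
    using e' f by (simp add: co_def inj_eq)
  then show ?thesis
    using assms undominated_image[OF undominated e' f] undominated_image[OF undominated_co _ f, of "co e'"] finite_V
    by unfold_locales auto
qed

section \<open>The two twin extensions of \<open>QR13\<close>\<close>

lemma adj_add_vertex:
  "adj (add_vertex G S) (Some a) (Some b) = adj G a b"
  "adj (add_vertex G S) None (Some b) = (b \<in> S)"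
  "adj (add_vertex G S) (Some a) None = (a \<in> S)"
  "\<not> adj (add_vertex G S) None None"
  by (auto simp: adj_def add_vertex_def)

lemma pverts_QR13 [simp]: "pverts QR13 = {0..<13}"
  by (simp add: QR13_def)

lemma open_nbh_subset: "open_nbh QR13 w \<subseteq> {0..<13}"
  and closed_nbh_subset: "w \<in> {0..<13} \<Longrightarrow> closed_nbh QR13 w \<subseteq> {0..<13}"
  by (auto simp: closed_nbh_def open_nbh_def QR13_def)

lemma nc_graph_QR13: "nc_graph {0..<13} (adj QR13)"
proof unfold_locales
  have "co (adj QR13) x y = co paley_13 x y" if "x \<in> {0..<13}" "y \<in> {0..<13}" for x y
    using that by (simp add: co_def adj_QR13)
  then show "undominated {0..<13} (adj QR13)" "undominated {0..<13} (co (adj QR13))"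
    using paley.undominated paley.undominated_co
      undominated_cong[of "{0..<13}" "adj QR13" paley_13]
      undominated_cong[of "{0..<13}" "co (adj QR13)" "co paley_13"] by (simp_all add: adj_QR13)
qed (use paley_13_commute not_paley_13_refl adj_QR13 in auto)

lemma nc_graph_add_vertex_QR13:
  assumes w: "w \<in> {0..<13}" and S: "S \<in> {open_nbh QR13 w, closed_nbh QR13 w}"
  shows "pair_graph (add_vertex QR13 S)" "card (pverts (add_vertex QR13 S)) = 14"
    "nc_graph (pverts (add_vertex QR13 S)) (adj (add_vertex QR13 S))"
proof -
  let ?G = "add_vertex QR13 S"
  show G: "pair_graph ?G"
    using S w open_nbh_subset closed_nbh_subset
    by (intro pair_graph_add_vertex pair_graph_QR13) auto
  have V: "pverts ?G = insert None (Some ` {0..<13})"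
    by (simp add: add_vertex_def)
  then show "card (pverts ?G) = 14"
    by (simp add: card_image)
  interpret sgraph "pverts ?G" "adj ?G"
    using G by (rule sgraph_adj)
  have V': "pverts ?G - {None} = Some ` {0..<13}"
    using V by auto
  show "nc_graph (pverts ?G) (adj ?G)"
  proof (rule nc_graph_add_twin)
    show "nc_graph (pverts ?G - {None}) (adj ?G)"
      unfolding V' using nc_graph_QR13 sym irrefl
      by (intro nc_graph_image[where e = "adj QR13"]) (auto simp: adj_add_vertex)
    show "card (pverts ?G - {None}) \<in> {13, 14}"
      unfolding V' by (simp add: card_image)
    have "S = {v. adj QR13 w v} \<or> S = insert w {v. adj QR13 w v}"
      using S by (simp add: open_nbh_def closed_nbh_def adj_def)
    then show "twins (pverts ?G) (adj ?G) (Some w) None"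
      using w by (auto simp: twins_def V adj_add_vertex)
  qed
qed

section \<open>Classification\<close>

text \<open>One direction is the contraction of a dominating star, in the graph or in the
  complement. For the other, all degrees are 6 or 7, which meets the degree hypothesis of
  \<open>max_degree_minor_less\<close> on both sides.\<close>

lemma noncompliant_iff_nc_graph:
  assumes G: "pair_graph G" and 14: "card (pverts G) = 14"
  shows "\<not> compliant 3 G \<longleftrightarrow> nc_graph (pverts G) (adj G)"
proof -
  interpret sgraph "pverts G" "adj G"
    using G by (rule sgraph_adj)
  have co: "undominated (pverts G) (adj (complement G)) = undominated (pverts G) (co (adj G))"
    by (intro undominated_cong adj_complement)
  have compliant: "compliant 3 G \<longleftrightarrow> (\<exists>H. (is_minor H G \<or> is_minor H (complement G)) \<and> 14 \<le> max_degree H + 3)"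
    unfolding compliant_def 14 by (intro ex_cong1 conj_cong refl) linarith
  show ?thesis
  proof
    assume no: "\<not> compliant 3 G"
    have small: "max_degree H + 3 < card (pverts G)" if "is_minor H G \<or> is_minor H (complement G)" for H
      using no that 14 unfolding compliant by (metis not_le)
    have "undominated (pverts G) (adj G)"
      using small by (intro undominated_if_no_minor[OF G]) blast
    moreover have "undominated (pverts G) (adj (complement G))"
      using small undominated_if_no_minor[OF pair_graph_complement[OF G]] by simp
    ultimately show "nc_graph (pverts G) (adj G)"
      using co by unfold_locales simp_all
  next
    assume "nc_graph (pverts G) (adj G)"
    then interpret nc_graph "pverts G" "adj G" .
    have G': "pair_graph (complement G)"
      using G by (rule pair_graph_complement)
    have deg: "3 \<le> card (N x) \<and> card (N x) + 3 < 14" "3 \<le> card (M x) \<and> card (M x) + 3 < 14"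
      if "x \<in> pverts G" for x
      using card_N_ge_6[OF that] card_M_ge_6[OF that] card_N_M[OF that] 14 by simp_all
    have N: "{u. adj G x u} = N x" for x
      using G by (auto simp: N_def adj_def pair_graph_iff)
    have M: "{u. adj (complement G) x u} = M x" if "x \<in> pverts G" for x
      using that by (auto simp: M_def co_def adj_def complement_def)
    have "max_degree H + 3 < 14" if "is_minor H G" for H
      using max_degree_minor_less[OF G undominated _ _ that] deg(1) 14 unfolding N by simp
    moreover have "max_degree H + 3 < 14" if "is_minor H (complement G)" for H
      using max_degree_minor_less[OF G' _ _ _ that] undominated_co co deg(2) 14 M by simp
    ultimately show "\<not> compliant 3 G"
      unfolding compliant by (meson not_le)
  qed
qed

lemma digraph_isoI:
  assumes G: "pair_graph G" and H: "pair_graph H" and h: "bij_betw h (pverts G) (pverts H)"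
    and adj: "\<And>x y. x \<in> pverts G \<Longrightarrow> y \<in> pverts G \<Longrightarrow> adj G x y = adj H (h x) (h y)"
  shows "digraph_iso (with_proj G) (with_proj H)"
proof -
  interpret G: pair_graph G
    by fact
  define f where "f = \<lparr>iso_verts = h, iso_arcs = map_prod h h, iso_head = snd, iso_tail = fst\<rparr>"
  have inj: "inj_on h (pverts G)" and im: "h ` pverts G = pverts H"
    using h by (auto simp: bij_betw_def)
  have arcs: "parcs G \<subseteq> pverts G \<times> pverts G" "parcs H \<subseteq> pverts H \<times> pverts H"
    using G H by (auto simp: pair_graph_iff)
  have "inj_on (map_prod h h) (parcs G)"
    using map_prod_inj_on[OF inj inj] arcs(1) by (rule inj_on_subset)
  then have "pre_digraph.digraph_isomorphism (with_proj G) f"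
    unfolding pre_digraph.digraph_isomorphism_def using inj G.wf_digraph_axioms by (simp add: f_def)
  moreover have "map_prod h h ` parcs G = parcs H"
  proof
    show "map_prod h h ` parcs G \<subseteq> parcs H"
      using adj arcs(1) by (auto simp: adj_def)
    show "parcs H \<subseteq> map_prod h h ` parcs G"
    proof
      fix p assume p: "p \<in> parcs H"
      then have "fst p \<in> h ` pverts G" "snd p \<in> h ` pverts G"
        using arcs(2) im by auto
      then obtain x y where xy: "x \<in> pverts G" "y \<in> pverts G" "p = (h x, h y)"
        by (metis imageE prod.collapse)
      then have "(x, y) \<in> parcs G"
        using adj[of x y] p by (simp add: adj_def)
      then show "p \<in> map_prod h h ` parcs G"
        using xy by (auto simp: image_iff intro!: bexI[of _ "(x, y)"])
    qed
  qed
  then have "with_proj H = app_iso f (with_proj G)"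
    using im by (simp add: app_iso_def f_def with_proj_def)
  ultimately show ?thesis
    unfolding digraph_iso_def by blast
qed

lemma card_parcs_eq_if_digraph_iso:
  assumes "digraph_iso (with_proj G) (with_proj H)"
  shows "card (parcs G) = card (parcs H)"
proof -
  obtain f where f: "pre_digraph.digraph_isomorphism (with_proj G) f" "with_proj H = app_iso f (with_proj G)"
    using assms by (auto simp: digraph_iso_def)
  have "arcs (with_proj H) = arcs (app_iso f (with_proj G))"
    by (rule arg_cong[OF f(2)])
  then have "parcs H = iso_arcs f ` parcs G" "inj_on (iso_arcs f) (parcs G)"
    using f(1) by (simp_all add: pre_digraph.digraph_isomorphism_def)
  then show ?thesis
    by (simp add: card_image)
qed

lemma card_parcs_add_vertex:
  assumes "finite (parcs G)" "finite S"
  shows "card (parcs (add_vertex G S)) = card (parcs G) + 2 * card S"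
proof -
  let ?A = "map_prod Some Some ` parcs G" and ?B = "{None} \<times> Some ` S" and ?C = "Some ` S \<times> {None}"
  have "inj_on (map_prod Some Some) (parcs G)"
    by (rule inj_onI) auto
  then have "card ?A = card (parcs G)" "card ?B = card S" "card ?C = card S"
    by (simp_all add: card_image card_cartesian_product)
  moreover have "?A \<inter> ?B = {}" "(?A \<union> ?B) \<inter> ?C = {}"
    by auto
  ultimately show ?thesis
    using assms by (simp add: add_vertex_def card_Un_disjoint)
qed

lemma card_open_nbh:
  assumes "w \<in> {0..<13}"
  shows "card (open_nbh QR13 w) = 6"
proof -
  interpret nc_graph "{0..<13}" "adj QR13"
    by (rule nc_graph_QR13)
  have "open_nbh QR13 w = N w"
    using open_nbh_subset[of w] by (auto simp: open_nbh_def N_def adj_def)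
  then show ?thesis
    using card_13(1)[of w] assms by simp
qed

text \<open>The number of arcs tells the graphs apart: the new vertex contributes 2 * 6 arcs to one
  and 2 * 7 to the other.\<close>

lemma open_closed_twin_not_iso:
  assumes w: "w \<in> {0..<13}" "w' \<in> {0..<13}"
  shows "\<not> digraph_iso (with_proj (QR13_open_twin w)) (with_proj (QR13_closed_twin w'))"
proof
  assume "digraph_iso (with_proj (QR13_open_twin w)) (with_proj (QR13_closed_twin w'))"
  then have eq: "card (parcs (QR13_open_twin w)) = card (parcs (QR13_closed_twin w'))"
    by (rule card_parcs_eq_if_digraph_iso)
  have fin: "finite (parcs QR13)" "finite (open_nbh QR13 v)" for v
    using finite_subset[OF open_nbh_subset] by (auto simp: QR13_def intro: finite_subset[of _ "{0..<13} \<times> {0..<13}"])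
  have "w' \<notin> open_nbh QR13 w'"
    by (simp add: open_nbh_def QR13_def)
  then have "card (closed_nbh QR13 w') = 7"
    using card_open_nbh[OF w(2)] fin by (simp add: closed_nbh_def)
  then show False
    using eq card_open_nbh[OF w(1)] fin
    by (simp add: QR13_open_twin_def QR13_closed_twin_def card_parcs_add_vertex closed_nbh_def)
qed

text \<open>Adjacent twins lead to the closed neighbourhood, non-adjacent ones to the open
  neighbourhood. The deleted twin becomes \<open>None\<close>.\<close>

lemma iso_twin_extension:
  assumes G: "pair_graph G" and 14: "card (pverts G) = 14" and nc: "nc_graph (pverts G) (adj G)"
    and w: "w \<in> {0..<13}" "w' \<in> {0..<13}"
  shows "digraph_iso (with_proj G) (with_proj (QR13_open_twin w)) \<or>
    digraph_iso (with_proj G) (with_proj (QR13_closed_twin w'))"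
proof -
  let ?V = "pverts G" and ?e = "adj G"
  interpret nc_graph ?V ?e
    by fact
  obtain x y where tw: "twins ?V ?e x y"
    using ex_twins[OF 14] by blast
  then have xy: "x \<in> ?V" "y \<in> ?V" "x \<noteq> y"
    by (auto simp: twins_def)
  have e_y: "?e v y = ?e v x" "?e y v = ?e v x" if "v \<in> ?V" "v \<noteq> x" "v \<noteq> y" for v
    using tw that sym[of v x] sym[of x v] sym[of v y] sym[of y v] unfolding twins_def by blast+
  interpret R: nc_graph "?V - {y}" ?e
    using tw by (rule nc_graph_remove_twin)
  have "card (?V - {y}) = 13"
    using 14 xy by simp
  then obtain h where h: "bij_betw h (?V - {y}) {0..<13}"
      "\<And>a b. a \<in> ?V - {y} \<Longrightarrow> b \<in> ?V - {y} \<Longrightarrow> ?e a b = paley_13 (h a) (h b)"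
    using R.paley_labelling by metis
  have iso: "digraph_iso (with_proj G) (with_proj (add_vertex QR13 S))"
    if z: "z \<in> {0..<13}" and S: "S = (if ?e x y then closed_nbh QR13 z else open_nbh QR13 z)" for z S
  proof (rule digraph_isoI[OF G])
    show H: "pair_graph (add_vertex QR13 S)"
      using nc_graph_add_vertex_QR13(1)[OF z] S by auto
    \<comment> \<open>The translation carries the label of the remaining twin \<open>x\<close> to
      \<open>z\<close>, so that any prescribed vertex can be the one that is doubled.\<close>
    define g where "g v = (h v + (z - h x)) mod 13" for v
    have hV: "h v \<in> {0..<13}" if "v \<in> ?V - {y}" for v
      using h(1) that by (auto simp: bij_betw_def)
    have g_x: "g x = z"
      using z by (simp add: g_def)
    have g_e: "?e a b = adj QR13 (g a) (g b)" if "a \<in> ?V - {y}" "b \<in> ?V - {y}" for a b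
      using h(2)[OF that] paley_13_shift by (simp add: g_def adj_QR13)
    have "inj_on (\<lambda>a. (a + (z - h x)) mod 13) {0..<13}"
      by (rule inj_on_inverseI[where g = "\<lambda>a. (a - (z - h x)) mod 13"]) (rule mod_13_shift(1))
    then have inj: "inj_on g (?V - {y})"
      using h(1) comp_inj_on[of h "?V - {y}" "\<lambda>a. (a + (z - h x)) mod 13"]
      by (simp add: bij_betw_def g_def[abs_def] comp_def)
    moreover have "g ` (?V - {y}) \<subseteq> {0..<13}"
      by (auto simp: g_def)
    moreover have "card (g ` (?V - {y})) = card {0..<13::int}"
      using card_image[OF inj] \<open>card (?V - {y}) = 13\<close> by simp
    ultimately have im: "g ` (?V - {y}) = {0..<13}"
      by (metis card_subset_eq finite_atLeastLessThan_int)
    define k where "k v = (if v = y then None else Some (g v))" for v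
    have "inj_on k ?V"
      using inj by (auto simp: inj_on_def k_def)
    moreover have "k ` ?V = insert None (Some ` {0..<13})"
      unfolding im[symmetric] using xy by (auto simp: k_def image_iff)
    ultimately show "bij_betw k ?V (pverts (add_vertex QR13 S))"
      by (simp add: bij_betw_def add_vertex_def)
    have S_iff: "g v \<in> S \<longleftrightarrow> ?e v y" if v: "v \<in> ?V - {y}" for v
    proof (cases "v = x")
      case True
      have "g x \<in> open_nbh QR13 z \<longleftrightarrow> False"
        by (simp add: g_x open_nbh_def QR13_def)
      then show ?thesis
        using True by (simp add: S closed_nbh_def g_x)
    next
      case False
      have "g v \<noteq> z"
        using False g_x inj v xy by (auto simp: inj_on_def)
      then have "g v \<in> S \<longleftrightarrow> adj QR13 z (g v)"
        by (simp add: S closed_nbh_def open_nbh_def adj_def)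
      also have "\<dots> \<longleftrightarrow> ?e x v"
        using g_e[of x v] v xy g_x by simp
      also have "\<dots> \<longleftrightarrow> ?e v y"
        using e_y(1)[of v] v False sym by blast
      finally show ?thesis .
    qed
    show "?e a b = adj (add_vertex QR13 S) (k a) (k b)" if ab: "a \<in> ?V" "b \<in> ?V" for a b
    proof (cases "a = y"; cases "b = y")
      assume "a = y" "b = y"
      then show ?thesis
        using irrefl by (simp add: k_def adj_add_vertex)
    next
      assume "a = y" "b \<noteq> y"
      then show ?thesis
        using S_iff[of b] ab sym[of b y] sym[of y b] by (auto simp: k_def adj_add_vertex)
    next
      assume "a \<noteq> y" "b = y"
      then show ?thesis
        using S_iff[of a] ab by (auto simp: k_def adj_add_vertex)
    next
      assume "a \<noteq> y" "b \<noteq> y"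
      then show ?thesis
        using g_e[of a b] ab by (simp add: k_def adj_add_vertex)
    qed
  qed
  show ?thesis
    using iso[OF w(1)] iso[OF w(2)] by (cases "?e x y") (auto simp: QR13_open_twin_def QR13_closed_twin_def)
qed

theorem theorem13:
  fixes w w' :: int
  assumes "w \<in> pverts QR13" and "w' \<in> pverts QR13"
  shows "(pair_graph (QR13_open_twin w) \<and> card (pverts (QR13_open_twin w)) = 14 \<and>
            \<not> compliant 3 (QR13_open_twin w)) \<and>
         (pair_graph (QR13_closed_twin w') \<and> card (pverts (QR13_closed_twin w')) = 14 \<and>
            \<not> compliant 3 (QR13_closed_twin w')) \<and>
         \<not> digraph_iso (with_proj (QR13_open_twin w)) (with_proj (QR13_closed_twin w')) \<and>
         (\<forall>G :: 'a pair_pre_digraph.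
            pair_graph G \<and> card (pverts G) = 14 \<and> \<not> compliant 3 G \<longrightarrow>
              digraph_iso (with_proj G) (with_proj (QR13_open_twin w)) \<or>
              digraph_iso (with_proj G) (with_proj (QR13_closed_twin w')))"
proof (intro conjI allI impI)
  have w: "w \<in> {0..<13}" "w' \<in> {0..<13}"
    using assms by simp_all
  show o: "pair_graph (QR13_open_twin w)" "card (pverts (QR13_open_twin w)) = 14"
    and c: "pair_graph (QR13_closed_twin w')" "card (pverts (QR13_closed_twin w')) = 14"
    using nc_graph_add_vertex_QR13(1,2)[OF w(1)] nc_graph_add_vertex_QR13(1,2)[OF w(2)]
    by (simp_all add: QR13_open_twin_def QR13_closed_twin_def)
  show "\<not> compliant 3 (QR13_open_twin w)"
    using noncompliant_iff_nc_graph[OF o] nc_graph_add_vertex_QR13(3)[OF w(1)] by (simp add: QR13_open_twin_def)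
  show "\<not> compliant 3 (QR13_closed_twin w')"
    using noncompliant_iff_nc_graph[OF c] nc_graph_add_vertex_QR13(3)[OF w(2)] by (simp add: QR13_closed_twin_def)
  show "\<not> digraph_iso (with_proj (QR13_open_twin w)) (with_proj (QR13_closed_twin w'))"
    using open_closed_twin_not_iso[OF w] .
next
  fix G :: "'a pair_pre_digraph"
  assume G: "pair_graph G \<and> card (pverts G) = 14 \<and> \<not> compliant 3 G"
  then show "digraph_iso (with_proj G) (with_proj (QR13_open_twin w)) \<or>
      digraph_iso (with_proj G) (with_proj (QR13_closed_twin w'))"
    using iso_twin_extension[of G w w'] noncompliant_iff_nc_graph[of G] assms by simp
qed

end
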